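(* Let $\mathcal{C}$ be a category satisfying at least one of the following: (a) $\mathcal{C}$ is a locally finite extensive category; (b) $\mathcal{C}$ has finite coproducts and every object of $\mathcal{C}$ is a finite coproduct of connected objects. Let $C_i$ $(i\in I)$ be representatives of the set of isomorphism classes of connected objects of $\mathcal{C}$. Then the canonical monoid homomorphism $$(\operatorname{Dec}(\mathcal{C}),+)\to(\operatorname{Dec}(\mathcal{C}),+,-)$$ is injective. If moreover $\mathcal{C}$ is combinatorial (in particular locally finite), then the group homomorphism $$\prod_{i\in I}h_{C_i}:(\operatorname{Dec}(\mathcal{C}),+,-)\to\prod_{i\in I}(\mathbb{Z},+),$$ obtained by extending $\prod_{i\in I}h_{C_i}:(\operatorname{Dec}(\mathcal{C}),+)\to\prod_{i\in I}(\mathbb{N},+)$ to the Grothendieck group, is injective. In this case, if $\mathcal{C}$ has finite products, then the canonical map is an injection of semi-rings $$(\operatorname{Dec}(\mathcal{C}),+,\times)\hookrightarrow(\operatorname{Dec}(\mathcal{C}),+,-,\times),$$ and the extension of $\prod_{i\in I}h_{C_i}$ is an injective ring homomorphism $$(\operatorname{Dec}(\mathcal{C}),+,-,\times)\to\prod_{i\in I}(\mathbb{Z},+,\times).$$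
   Context: A category is locally finite if the hom-set between any two objects is a finite set. The coproduct is written $A+B$, the initial object is $0$, and the canonical morphism $i_A:A\to A+B$ is called a coprojection. A finite coproduct may be empty, in which case it is $0$. In a category with finite coproducts, an object $C$ is connected if for all objects $A,B$ the natural map $\operatorname{Hom}(C,A)\coprod\operatorname{Hom}(C,B)\to\operatorname{Hom}(C,A+B)$ is bijective. A category is extensive if it has finite coproducts and: (i) for any morphism $f:A\to X_1+X_2$, the pullback of $f$ along the coprojection $i_{X_1}:X_1\to X_1+X_2$ exists; (ii) for any commutative diagram consisting of a row $A_1\to A\leftarrow A_2$, the row $X_1\xrightarrow{i_{X_1}}X_1+X_2\xleftarrow{i_{X_2}}X_2$, and vertical morphisms $A_1\to X_1$, $f:A\to X_1+X_2$, $A_2\to X_2$, the row $A_1\to A\leftarrow A_2$ is a coproduct diagram if and only if both squares are pullbacks. A locally finite category is combinatorial if, whenever two objects $A,B$ satisfy $\#\operatorname{Hom}(X,A)=\#\operatorname{Hom}(X,B)$ for all objects $X$, then $A\cong B$. $\operatorname{Dec}(\mathcal{C})$ is the set of isomorphism classes $[A]$ of objects of $\mathcal{C}$. $(\operatorname{Dec}(\mathcal{C}),+)$ is the monoid with $[A]+[B]=[A+B]$ and unit $[0]$. When $\mathcal{C}$ has finite products, $\times$ is given by $[A]\times[B]=[A\times B]$ with unit the class of the terminal object; it is known that an extensive category with finite products is distributive, so $(\operatorname{Dec}(\mathcal{C}),+,\times)$ is a semi-ring. (A category satisfying (b) is extensive.) For an object $D$ of a locally finite category, $h_D:\operatorname{Dec}(\mathcal{C})\to\mathbb{N}$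 is $[A]\mapsto\#\operatorname{Hom}(D,A)$; for $D$ connected it is a monoid morphism for $+$. $(\operatorname{Dec}(\mathcal{C}),+,-)$ denotes the Grothendieck group of the monoid $(\operatorname{Dec}(\mathcal{C}),+)$ (the universal group, i.e. left adjoint to the forgetful functor from commutative groups to commutative monoids), and $(\operatorname{Dec}(\mathcal{C}),+,-,\times)$ is the ring obtained in the same way from the semi-ring $(\operatorname{Dec}(\mathcal{C}),+,\times)$. $\mathbb{N}$ is the semi-ring of non-negative integers. Monoids are commutative. A semi-ring is a set with two commutative monoid structures $(+,0)$ and $(\times,1)$ satisfying the distributive laws and $0\times x=0$ for all $x$. *)

theory Defs
  imports "HOL-Algebra.Product_Groups" "HOL-Algebra.IntRing"
begin

section \<open>Categories\<close>

record ('o, 'm) category_data =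
  Obj :: "'o set"
  Arr :: "'m set"
  Dom :: "'m \<Rightarrow> 'o"
  Cod :: "'m \<Rightarrow> 'o"
  Idt :: "'o \<Rightarrow> 'm"
  Cmp :: "'m \<Rightarrow> 'm \<Rightarrow> 'm"  (infixr \<open>\<bullet>\<index>\<close> 70)

definition Hom :: "('o, 'm, 'x) category_data_scheme \<Rightarrow> 'o \<Rightarrow> 'o \<Rightarrow> 'm set"
  where "Hom C A B = {f \<in> Arr C. Dom C f = A \<and> Cod C f = B}"

text \<open>Composition is written in the usual order: \<open>g \<bullet>\<^bsub>C\<^esub> f\<close> is "first \<open>f\<close>, then \<open>g\<close>".
  It is only constrained on composable pairs.\<close>

locale category =
  fixes C :: "('o, 'm) category_data" (structure)
  assumes Dom_Obj: "f \<in> Arr C \<Longrightarrow> Dom C f \<in> Obj C"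
    and Cod_Obj: "f \<in> Arr C \<Longrightarrow> Cod C f \<in> Obj C"
    and Idt_Hom: "A \<in> Obj C \<Longrightarrow> Idt C A \<in> Hom C A A"
    and Cmp_Hom: "f \<in> Hom C A B \<Longrightarrow> g \<in> Hom C B D \<Longrightarrow> g \<bullet> f \<in> Hom C A D"
    and Cmp_Idt: "f \<in> Hom C A B \<Longrightarrow> f \<bullet> Idt C A = f"
    and Idt_Cmp: "f \<in> Hom C A B \<Longrightarrow> Idt C B \<bullet> f = f"
    and Cmp_assoc: "f \<in> Hom C A B \<Longrightarrow> g \<in> Hom C B D \<Longrightarrow> h \<in> Hom C D E
        \<Longrightarrow> (h \<bullet> g) \<bullet> f = h \<bullet> (g \<bullet> f)"

definition locally_finite :: "('o, 'm) category_data \<Rightarrow> bool"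
  where "locally_finite C \<longleftrightarrow> (\<forall>A\<in>Obj C. \<forall>B\<in>Obj C. finite (Hom C A B))"

definition isomorphic :: "('o, 'm) category_data \<Rightarrow> 'o \<Rightarrow> 'o \<Rightarrow> bool"
  where "isomorphic C A B \<longleftrightarrow>
    (\<exists>f\<in>Hom C A B. \<exists>g\<in>Hom C B A. g \<bullet>\<^bsub>C\<^esub> f = Idt C A \<and> f \<bullet>\<^bsub>C\<^esub> g = Idt C B)"

subsection \<open>Coproducts, products and pullbacks\<close>

text \<open>\<open>S\<close> with the coprojections \<open>c k : X k \<rightarrow> S\<close> is a coproduct of the family \<open>X\<close>
  over the index set \<open>K\<close>; for \<open>K = {}\<close> this says that \<open>S\<close> is initial.\<close>

definition is_coproduct ::
    "('o, 'm) category_data \<Rightarrow> 'k set \<Rightarrow> ('k \<Rightarrow> 'o) \<Rightarrow> 'o \<Rightarrow> ('k \<Rightarrow> 'm) \<Rightarrow> bool"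
  where "is_coproduct C K X S c \<longleftrightarrow>
    S \<in> Obj C \<and> (\<forall>k\<in>K. X k \<in> Obj C \<and> c k \<in> Hom C (X k) S) \<and>
    (\<forall>T\<in>Obj C. \<forall>f. (\<forall>k\<in>K. f k \<in> Hom C (X k) T) \<longrightarrow>
      (\<exists>!u. u \<in> Hom C S T \<and> (\<forall>k\<in>K. u \<bullet>\<^bsub>C\<^esub> c k = f k)))"

definition is_product ::
    "('o, 'm) category_data \<Rightarrow> 'k set \<Rightarrow> ('k \<Rightarrow> 'o) \<Rightarrow> 'o \<Rightarrow> ('k \<Rightarrow> 'm) \<Rightarrow> bool"
  where "is_product C K X P p \<longleftrightarrow>
    P \<in> Obj C \<and> (\<forall>k\<in>K. X k \<in> Obj C \<and> p k \<in> Hom C P (X k)) \<and>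
    (\<forall>T\<in>Obj C. \<forall>f. (\<forall>k\<in>K. f k \<in> Hom C T (X k)) \<longrightarrow>
      (\<exists>!u. u \<in> Hom C T P \<and> (\<forall>k\<in>K. p k \<bullet>\<^bsub>C\<^esub> u = f k)))"

definition has_finite_coproducts :: "('o, 'm) category_data \<Rightarrow> bool"
  where "has_finite_coproducts C \<longleftrightarrow>
    (\<forall>(n::nat) X. (\<forall>k<n. X k \<in> Obj C) \<longrightarrow> (\<exists>S c. is_coproduct C {..<n} X S c))"

definition has_finite_products :: "('o, 'm) category_data \<Rightarrow> bool"
  where "has_finite_products C \<longleftrightarrow>
    (\<forall>(n::nat) X. (\<forall>k<n. X k \<in> Obj C) \<longrightarrow> (\<exists>P p. is_product C {..<n} X P p))"

definition is_initial :: "('o, 'm) category_data \<Rightarrow> 'o \<Rightarrow> bool"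
  where "is_initial C Z \<longleftrightarrow> Z \<in> Obj C \<and> (\<forall>A\<in>Obj C. \<exists>!f. f \<in> Hom C Z A)"

definition is_terminal :: "('o, 'm) category_data \<Rightarrow> 'o \<Rightarrow> bool"
  where "is_terminal C Z \<longleftrightarrow> Z \<in> Obj C \<and> (\<forall>A\<in>Obj C. \<exists>!f. f \<in> Hom C A Z)"

text \<open>\<open>A \<rightarrow> S \<leftarrow> B\<close>, with arrows \<open>i\<close> and \<open>j\<close>, is a binary coproduct diagram. Instead of fixing
  one choice of \<open>A + B\<close>, all notions below quantify over all such diagrams.\<close>

definition is_coproduct2 ::
    "('o, 'm) category_data \<Rightarrow> 'o \<Rightarrow> 'o \<Rightarrow> 'o \<Rightarrow> 'm \<Rightarrow> 'm \<Rightarrow> bool"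
  where "is_coproduct2 C A B S i j \<longleftrightarrow>
    A \<in> Obj C \<and> B \<in> Obj C \<and> S \<in> Obj C \<and> i \<in> Hom C A S \<and> j \<in> Hom C B S \<and>
    (\<forall>T\<in>Obj C. \<forall>f\<in>Hom C A T. \<forall>g\<in>Hom C B T.
      \<exists>!u. u \<in> Hom C S T \<and> u \<bullet>\<^bsub>C\<^esub> i = f \<and> u \<bullet>\<^bsub>C\<^esub> j = g)"

definition is_product2 ::
    "('o, 'm) category_data \<Rightarrow> 'o \<Rightarrow> 'o \<Rightarrow> 'o \<Rightarrow> 'm \<Rightarrow> 'm \<Rightarrow> bool"
  where "is_product2 C A B P p q \<longleftrightarrow>
    A \<in> Obj C \<and> B \<in> Obj C \<and> P \<in> Obj C \<and> p \<in> Hom C P A \<and> q \<in> Hom C P B \<and>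
    (\<forall>T\<in>Obj C. \<forall>f\<in>Hom C T A. \<forall>g\<in>Hom C T B.
      \<exists>!u. u \<in> Hom C T P \<and> p \<bullet>\<^bsub>C\<^esub> u = f \<and> q \<bullet>\<^bsub>C\<^esub> u = g)"

text \<open>The square with \<open>p : P \<rightarrow> A\<close>, \<open>q : P \<rightarrow> X\<close>, \<open>f : A \<rightarrow> S\<close>, \<open>i : X \<rightarrow> S\<close>
  is a pullback, that is, \<open>P\<close> is the pullback of \<open>f\<close> along \<open>i\<close>.\<close>

definition is_pullback ::
    "('o, 'm) category_data \<Rightarrow> 'o \<Rightarrow> 'm \<Rightarrow> 'm \<Rightarrow> 'm \<Rightarrow> 'm \<Rightarrow> bool"
  where "is_pullback C P p q f i \<longleftrightarrow>
    P \<in> Obj C \<and> f \<in> Arr C \<and> i \<in> Arr C \<and> Cod C f = Cod C i \<and>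
    p \<in> Hom C P (Dom C f) \<and> q \<in> Hom C P (Dom C i) \<and> f \<bullet>\<^bsub>C\<^esub> p = i \<bullet>\<^bsub>C\<^esub> q \<and>
    (\<forall>T\<in>Obj C. \<forall>a\<in>Hom C T (Dom C f). \<forall>b\<in>Hom C T (Dom C i). f \<bullet>\<^bsub>C\<^esub> a = i \<bullet>\<^bsub>C\<^esub> b \<longrightarrow>
      (\<exists>!u. u \<in> Hom C T P \<and> p \<bullet>\<^bsub>C\<^esub> u = a \<and> q \<bullet>\<^bsub>C\<^esub> u = b))"

subsection \<open>Connected objects, extensive and combinatorial categories\<close>

definition connected_object :: "('o, 'm) category_data \<Rightarrow> 'o \<Rightarrow> bool"
  where "connected_object C D \<longleftrightarrow> D \<in> Obj C \<and>
    (\<forall>A B S i j. is_coproduct2 C A B S i j \<longrightarrow>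
      bij_betw (case_sum (\<lambda>f. i \<bullet>\<^bsub>C\<^esub> f) (\<lambda>g. j \<bullet>\<^bsub>C\<^esub> g)) (Hom C D A <+> Hom C D B) (Hom C D S))"

definition extensive :: "('o, 'm) category_data \<Rightarrow> bool"
  where "extensive C \<longleftrightarrow> has_finite_coproducts C \<and>
    (\<forall>X\<^sub>1 X\<^sub>2 S i\<^sub>1 i\<^sub>2. is_coproduct2 C X\<^sub>1 X\<^sub>2 S i\<^sub>1 i\<^sub>2 \<longrightarrow>
      (\<forall>A f. f \<in> Hom C A S \<longrightarrow> (\<exists>P p q. is_pullback C P p q f i\<^sub>1)) \<and>
      (\<forall>A A\<^sub>1 A\<^sub>2 a\<^sub>1 a\<^sub>2 g\<^sub>1 g\<^sub>2 f.
        a\<^sub>1 \<in> Hom C A\<^sub>1 A \<and> a\<^sub>2 \<in> Hom C A\<^sub>2 A \<and>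
        g\<^sub>1 \<in> Hom C A\<^sub>1 X\<^sub>1 \<and> g\<^sub>2 \<in> Hom C A\<^sub>2 X\<^sub>2 \<and> f \<in> Hom C A S \<and>
        f \<bullet>\<^bsub>C\<^esub> a\<^sub>1 = i\<^sub>1 \<bullet>\<^bsub>C\<^esub> g\<^sub>1 \<and> f \<bullet>\<^bsub>C\<^esub> a\<^sub>2 = i\<^sub>2 \<bullet>\<^bsub>C\<^esub> g\<^sub>2 \<longrightarrow>
        (is_coproduct2 C A\<^sub>1 A\<^sub>2 A a\<^sub>1 a\<^sub>2 \<longleftrightarrow>
          is_pullback C A\<^sub>1 a\<^sub>1 g\<^sub>1 f i\<^sub>1 \<and> is_pullback C A\<^sub>2 a\<^sub>2 g\<^sub>2 f i\<^sub>2)))"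

definition combinatorial :: "('o, 'm) category_data \<Rightarrow> bool"
  where "combinatorial C \<longleftrightarrow> locally_finite C \<and>
    (\<forall>A\<in>Obj C. \<forall>B\<in>Obj C.
      (\<forall>X\<in>Obj C. card (Hom C X A) = card (Hom C X B)) \<longrightarrow> isomorphic C A B)"

definition finite_coproducts_of_connected :: "('o, 'm) category_data \<Rightarrow> bool"
  where "finite_coproducts_of_connected C \<longleftrightarrow>
    (\<forall>A\<in>Obj C. \<exists>(n::nat) X c. (\<forall>k<n. connected_object C (X k)) \<and> is_coproduct C {..<n} X A c)"

text \<open>\<open>(R i)\<close>, \<open>i \<in> I\<close>, contains exactly one object from each isomorphism class of
  connected objects.\<close>

definition connected_representatives ::
    "('o, 'm) category_data \<Rightarrow> 'i set \<Rightarrow> ('i \<Rightarrow> 'o) \<Rightarrow> bool"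
  where "connected_representatives C I R \<longleftrightarrow>
    (\<forall>i\<in>I. connected_object C (R i)) \<and>
    (\<forall>D. connected_object C D \<longrightarrow> (\<exists>!i. i \<in> I \<and> isomorphic C D (R i)))"

section \<open>The monoid and semi-ring of isomorphism classes\<close>

definition iso_class :: "('o, 'm) category_data \<Rightarrow> 'o \<Rightarrow> 'o set"
  where "iso_class C A = {B \<in> Obj C. isomorphic C A B}"

text \<open>The sum of two classes is the set of all coproducts of representatives, which is the class
  \<open>[A + B]\<close> whenever the coproduct exists (see \<open>dec_monoid_add\<close> below). The zero, the product and
  the one are treated in the same way.\<close>

definition dec_monoid :: "('o, 'm) category_data \<Rightarrow> 'o set monoid"
  where "dec_monoid C = \<lparr>
    carrier = iso_class C ` Obj C,
    monoid.mult = (\<lambda>x y. {S. \<exists>A\<in>x. \<exists>B\<in>y. \<exists>i j. is_coproduct2 C A B S i j}),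
    one = {Z. is_initial C Z}\<rparr>"

definition dec_semiring :: "('o, 'm) category_data \<Rightarrow> 'o set ring"
  where "dec_semiring C = \<lparr>
    carrier = carrier (dec_monoid C),
    monoid.mult = (\<lambda>x y. {P. \<exists>A\<in>x. \<exists>B\<in>y. \<exists>p q. is_product2 C A B P p q}),
    one = {Z. is_terminal C Z},
    zero = one (dec_monoid C),
    add = monoid.mult (dec_monoid C)\<rparr>"

text \<open>\<open>hom_count C D [A] = #Hom(D, A)\<close>.\<close>

definition hom_count :: "('o, 'm) category_data \<Rightarrow> 'o \<Rightarrow> 'o set \<Rightarrow> nat"
  where "hom_count C D x = the_elem ((\<lambda>A. card (Hom C D A)) ` x)"

section \<open>Grothendieck group and ring\<close>

text \<open>Following HOL-Algebra, commutative monoids and groups are written multiplicatively.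
  The pair \<open>(a, b)\<close> stands for the formal difference \<open>a - b\<close>.\<close>

definition groth_rel :: "('a, 'b) monoid_scheme \<Rightarrow> (('a \<times> 'a) \<times> ('a \<times> 'a)) set"
  where "groth_rel M = {((a, b), (c, d)).
    a \<in> carrier M \<and> b \<in> carrier M \<and> c \<in> carrier M \<and> d \<in> carrier M \<and>
    (\<exists>k\<in>carrier M. a \<otimes>\<^bsub>M\<^esub> d \<otimes>\<^bsub>M\<^esub> k = c \<otimes>\<^bsub>M\<^esub> b \<otimes>\<^bsub>M\<^esub> k)}"

definition groth_diff :: "('a, 'b) monoid_scheme \<Rightarrow> 'a \<Rightarrow> 'a \<Rightarrow> ('a \<times> 'a) set"
  where "groth_diff M a b = groth_rel M `` {(a, b)}"

definition groth_group :: "('a, 'b) monoid_scheme \<Rightarrow> ('a \<times> 'a) set monoid"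
  where "groth_group M = \<lparr>
    carrier = (carrier M \<times> carrier M) // groth_rel M,
    monoid.mult = (\<lambda>X Y. \<Union>(a, b)\<in>X. \<Union>(c, d)\<in>Y. groth_diff M (a \<otimes>\<^bsub>M\<^esub> c) (b \<otimes>\<^bsub>M\<^esub> d)),
    one = groth_diff M \<one>\<^bsub>M\<^esub> \<one>\<^bsub>M\<^esub>\<rparr>"

definition groth_map :: "('a, 'b) monoid_scheme \<Rightarrow> 'a \<Rightarrow> ('a \<times> 'a) set"
  where "groth_map M a = groth_diff M a \<one>\<^bsub>M\<^esub>"

text \<open>The extension \<open>a - b \<mapsto> f a - f b\<close> of a monoid homomorphism \<open>f : M \<rightarrow> H\<close> into a
  commutative group.\<close>

definition groth_ext ::
    "('c, 'd) monoid_scheme \<Rightarrow> ('a \<Rightarrow> 'c) \<Rightarrow> ('a \<times> 'a) set \<Rightarrow> 'c"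
  where "groth_ext H f X = the_elem ((\<lambda>(a, b). f a \<otimes>\<^bsub>H\<^esub> inv\<^bsub>H\<^esub> (f b)) ` X)"

text \<open>On formal differences \<open>(a - b) * (c - d) = (a * c + b * d) - (a * d + b * c)\<close>.\<close>

definition groth_ring :: "('a, 'b) ring_scheme \<Rightarrow> ('a \<times> 'a) set ring"
  where "groth_ring R = \<lparr>
    carrier = carrier (groth_group (add_monoid R)),
    monoid.mult = (\<lambda>X Y. \<Union>(a, b)\<in>X. \<Union>(c, d)\<in>Y.
      groth_diff (add_monoid R)
        (a \<otimes>\<^bsub>R\<^esub> c \<oplus>\<^bsub>R\<^esub> b \<otimes>\<^bsub>R\<^esub> d) (a \<otimes>\<^bsub>R\<^esub> d \<oplus>\<^bsub>R\<^esub> b \<otimes>\<^bsub>R\<^esub> c)),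
    one = groth_diff (add_monoid R) \<one>\<^bsub>R\<^esub> \<zero>\<^bsub>R\<^esub>,
    zero = one (groth_group (add_monoid R)),
    add = monoid.mult (groth_group (add_monoid R))\<rparr>"

definition product_ring :: "'i set \<Rightarrow> ('i \<Rightarrow> ('a, 'b) ring_scheme) \<Rightarrow> ('i \<Rightarrow> 'a) ring"
  where "product_ring I R = \<lparr>
    carrier = (\<Pi>\<^sub>E i\<in>I. carrier (R i)),
    monoid.mult = (\<lambda>x y. \<lambda>i\<in>I. x i \<otimes>\<^bsub>R i\<^esub> y i),
    one = (\<lambda>i\<in>I. \<one>\<^bsub>R i\<^esub>),
    zero = (\<lambda>i\<in>I. \<zero>\<^bsub>R i\<^esub>),
    add = (\<lambda>x y. \<lambda>i\<in>I. x i \<oplus>\<^bsub>R i\<^esub> y i)\<rparr>"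

definition hom_count_prod ::
    "('o, 'm) category_data \<Rightarrow> 'i set \<Rightarrow> ('i \<Rightarrow> 'o) \<Rightarrow> 'o set \<Rightarrow> 'i \<Rightarrow> nat"
  where "hom_count_prod C I R x = (\<lambda>i\<in>I. hom_count C (R i) x)"

definition hom_count_ext ::
    "('o, 'm) category_data \<Rightarrow> 'i set \<Rightarrow> ('i \<Rightarrow> 'o) \<Rightarrow> ('o set \<times> 'o set) set \<Rightarrow> 'i \<Rightarrow> int"
  where "hom_count_ext C I R =
    groth_ext (product_group I (\<lambda>_. integer_group)) (\<lambda>x. \<lambda>i\<in>I. int (hom_count_prod C I R x i))"

section \<open>Adequacy of the encodings\<close>

lemma add_monoid_dec_semiring: "add_monoid (dec_semiring C) = dec_monoid C"
  by (simp add: dec_semiring_def dec_monoid_def)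

lemma is_coproduct_empty: "is_coproduct C {} X S c \<longleftrightarrow> is_initial C S"
  by (simp add: is_coproduct_def is_initial_def)

lemma is_product_empty: "is_product C {} X S p \<longleftrightarrow> is_terminal C S"
  by (simp add: is_product_def is_terminal_def)

context category
begin

lemma HomD: "f \<in> Hom C A B \<Longrightarrow> A \<in> Obj C \<and> B \<in> Obj C"
  using Dom_Obj Cod_Obj by (auto simp: Hom_def)

lemma isomorphicI:
  "f \<in> Hom C A B \<Longrightarrow> g \<in> Hom C B A \<Longrightarrow> g \<bullet> f = Idt C A \<Longrightarrow> f \<bullet> g = Idt C B
    \<Longrightarrow> isomorphic C A B"
  by (auto simp: isomorphic_def)

lemma isomorphicE:
  assumes "isomorphic C A B"
  obtains f g where "f \<in> Hom C A B" "g \<in> Hom C B A" "g \<bullet> f = Idt C A" "f \<bullet> g = Idt C B"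
  using assms by (auto simp: isomorphic_def)

lemma isomorphic_refl: "A \<in> Obj C \<Longrightarrow> isomorphic C A A"
  using Idt_Hom Idt_Cmp isomorphicI by metis

lemma is_coproduct2_unique:
  assumes S: "is_coproduct2 C A B S i j" and S': "is_coproduct2 C A B S' i' j'"
  shows "isomorphic C S S'"
proof -
  have o: "S \<in> Obj C" "S' \<in> Obj C" and h: "i \<in> Hom C A S" "j \<in> Hom C B S" "i' \<in> Hom C A S'" "j' \<in> Hom C B S'"
    using S S' by (auto simp: is_coproduct2_def)
  obtain u where u: "u \<in> Hom C S S'" "u \<bullet> i = i'" "u \<bullet> j = j'"
    using S o h unfolding is_coproduct2_def by metis
  obtain v where v: "v \<in> Hom C S' S" "v \<bullet> i' = i" "v \<bullet> j' = j"
    using S' o h unfolding is_coproduct2_def by metis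
  have "\<exists>!w. w \<in> Hom C S S \<and> w \<bullet> i = i \<and> w \<bullet> j = j"
    using S o h unfolding is_coproduct2_def by blast
  moreover have "v \<bullet> u \<in> Hom C S S" "(v \<bullet> u) \<bullet> i = i" "(v \<bullet> u) \<bullet> j = j"
    using u v h Cmp_assoc Cmp_Hom by metis+
  moreover have "Idt C S \<in> Hom C S S" "Idt C S \<bullet> i = i" "Idt C S \<bullet> j = j"
    using h o Idt_Hom Idt_Cmp by metis+
  ultimately have 1: "v \<bullet> u = Idt C S" by blast
  have "\<exists>!w. w \<in> Hom C S' S' \<and> w \<bullet> i' = i' \<and> w \<bullet> j' = j'"
    using S' o h unfolding is_coproduct2_def by blast
  moreover have "u \<bullet> v \<in> Hom C S' S'" "(u \<bullet> v) \<bullet> i' = i'" "(u \<bullet> v) \<bullet> j' = j'"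
    using u v h Cmp_assoc Cmp_Hom by metis+
  moreover have "Idt C S' \<in> Hom C S' S'" "Idt C S' \<bullet> i' = i'" "Idt C S' \<bullet> j' = j'"
    using h o Idt_Hom Idt_Cmp by metis+
  ultimately have 2: "u \<bullet> v = Idt C S'" by blast
  show ?thesis using isomorphicI[OF u(1) v(1) 1 2] .
qed

lemma is_coproduct2_iso:
  assumes S: "is_coproduct2 C A B S i j"
    and a: "a \<in> Hom C A' A" "a' \<in> Hom C A A'" "a \<bullet> a' = Idt C A" "a' \<bullet> a = Idt C A'"
    and b: "b \<in> Hom C B' B" "b' \<in> Hom C B B'" "b \<bullet> b' = Idt C B" "b' \<bullet> b = Idt C B'"
    and s: "s \<in> Hom C S S'" "s' \<in> Hom C S' S" "s \<bullet> s' = Idt C S'" "s' \<bullet> s = Idt C S"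
  shows "is_coproduct2 C A' B' S' (s \<bullet> i \<bullet> a) (s \<bullet> j \<bullet> b)"
proof -
  have i: "i \<in> Hom C A S" and j: "j \<in> Hom C B S" using S by (auto simp: is_coproduct2_def)
  have o: "A' \<in> Obj C" "B' \<in> Obj C" "S' \<in> Obj C" using a b s HomD by blast+
  have ia: "i \<bullet> a \<in> Hom C A' S" and jb: "j \<bullet> b \<in> Hom C B' S"
    using i j a b Cmp_Hom by blast+
  have "\<exists>!u. u \<in> Hom C S' T \<and> u \<bullet> s \<bullet> i \<bullet> a = f \<and> u \<bullet> s \<bullet> j \<bullet> b = g"
    if T: "T \<in> Obj C" and f: "f \<in> Hom C A' T" and g: "g \<in> Hom C B' T" for T f g
  proof -
    have f': "f \<bullet> a' \<in> Hom C A T" and g': "g \<bullet> b' \<in> Hom C B T" using a b f g Cmp_Hom by blast+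
    have ex: "\<exists>!w. w \<in> Hom C S T \<and> w \<bullet> i = f \<bullet> a' \<and> w \<bullet> j = g \<bullet> b'"
      using S T f' g' unfolding is_coproduct2_def by blast
    then obtain w where w: "w \<in> Hom C S T" "w \<bullet> i = f \<bullet> a'" "w \<bullet> j = g \<bullet> b'" by blast
    have ws: "w \<bullet> s' \<in> Hom C S' T" using w s Cmp_Hom by blast
    have c1: "(w \<bullet> s') \<bullet> s = w" using w(1) s Cmp_assoc Cmp_Idt by metis
    have c2: "(w \<bullet> i) \<bullet> a = f" "(w \<bullet> j) \<bullet> b = g"
      using w a b f g Cmp_assoc Cmp_Idt by metis+
    have "(w \<bullet> s') \<bullet> s \<bullet> i \<bullet> a = f" "(w \<bullet> s') \<bullet> s \<bullet> j \<bullet> b = g"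
      using c1 c2 Cmp_assoc[OF ia s(1) ws] Cmp_assoc[OF jb s(1) ws]
        Cmp_assoc[OF a(1) i w(1)] Cmp_assoc[OF b(1) j w(1)] by simp_all
    moreover have "u = w \<bullet> s'"
      if u: "u \<in> Hom C S' T" "u \<bullet> s \<bullet> i \<bullet> a = f" "u \<bullet> s \<bullet> j \<bullet> b = g" for u
    proof -
      have us: "u \<bullet> s \<in> Hom C S T" using u s Cmp_Hom by blast
      have "(u \<bullet> s) \<bullet> i = ((u \<bullet> s) \<bullet> i) \<bullet> a \<bullet> a'"
        using a i us Cmp_Hom Cmp_Idt by metis
      also have "\<dots> = (((u \<bullet> s) \<bullet> i) \<bullet> a) \<bullet> a'"
        using Cmp_assoc[OF a(2) a(1) Cmp_Hom[OF i us]] by simp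
      also have "\<dots> = f \<bullet> a'"
        using Cmp_assoc[OF a(1) i us] Cmp_assoc[OF ia s(1) u(1)] u(2) by simp
      finally have 1: "(u \<bullet> s) \<bullet> i = f \<bullet> a'" .
      have "(u \<bullet> s) \<bullet> j = ((u \<bullet> s) \<bullet> j) \<bullet> b \<bullet> b'"
        using b j us Cmp_Hom Cmp_Idt by metis
      also have "\<dots> = (((u \<bullet> s) \<bullet> j) \<bullet> b) \<bullet> b'"
        using Cmp_assoc[OF b(2) b(1) Cmp_Hom[OF j us]] by simp
      also have "\<dots> = g \<bullet> b'"
        using Cmp_assoc[OF b(1) j us] Cmp_assoc[OF jb s(1) u(1)] u(3) by simp
      finally have "u \<bullet> s = w" using ex 1 us w by blast
      then have "w \<bullet> s' = u \<bullet> s \<bullet> s'" using Cmp_assoc[OF s(2) s(1) u(1)] by simp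
      then show ?thesis using s u Cmp_Idt by metis
    qed
    ultimately show ?thesis using ws by blast
  qed
  then show ?thesis
    using o Cmp_Hom[OF ia s(1)] Cmp_Hom[OF jb s(1)] unfolding is_coproduct2_def by blast
qed

lemma dec_monoid_add:
  assumes S: "is_coproduct2 C A B S i j"
  shows "iso_class C A \<otimes>\<^bsub>dec_monoid C\<^esub> iso_class C B = iso_class C S"
proof (rule equalityI; rule subsetI)
  fix S' assume "S' \<in> iso_class C A \<otimes>\<^bsub>dec_monoid C\<^esub> iso_class C B"
  then obtain A' B' i' j' where A': "isomorphic C A A'" and B': "isomorphic C B B'"
    and S': "is_coproduct2 C A' B' S' i' j'"
    by (auto simp: dec_monoid_def iso_class_def)
  obtain a a' where a: "a \<in> Hom C A A'" "a' \<in> Hom C A' A" "a' \<bullet> a = Idt C A" "a \<bullet> a' = Idt C A'"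
    using A' by (rule isomorphicE)
  obtain b b' where b: "b \<in> Hom C B B'" "b' \<in> Hom C B' B" "b' \<bullet> b = Idt C B" "b \<bullet> b' = Idt C B'"
    using B' by (rule isomorphicE)
  have o: "S' \<in> Obj C" using S' by (simp add: is_coproduct2_def)
  note s = Idt_Hom[OF o] Idt_Cmp[OF Idt_Hom[OF o]]
  have "is_coproduct2 C A B S' (Idt C S' \<bullet> i' \<bullet> a) (Idt C S' \<bullet> j' \<bullet> b)"
    using is_coproduct2_iso[OF S' a(1,2,4,3) b(1,2,4,3) s(1,1,2,2)] .
  then show "S' \<in> iso_class C S"
    using is_coproduct2_unique[OF S] o by (auto simp: iso_class_def)
next
  fix S' assume "S' \<in> iso_class C S"
  then have "isomorphic C S S'" by (simp add: iso_class_def)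
  then obtain s s' where s: "s \<in> Hom C S S'" "s' \<in> Hom C S' S" "s' \<bullet> s = Idt C S" "s \<bullet> s' = Idt C S'"
    by (rule isomorphicE)
  have o: "A \<in> Obj C" "B \<in> Obj C" using S by (auto simp: is_coproduct2_def)
  note a = Idt_Hom[OF o(1)] Idt_Cmp[OF Idt_Hom[OF o(1)]]
  note b = Idt_Hom[OF o(2)] Idt_Cmp[OF Idt_Hom[OF o(2)]]
  have "is_coproduct2 C A B S' (s \<bullet> i \<bullet> Idt C A) (s \<bullet> j \<bullet> Idt C B)"
    using is_coproduct2_iso[OF S a(1,1,2,2) b(1,1,2,2) s(1,2,4,3)] .
  then show "S' \<in> iso_class C A \<otimes>\<^bsub>dec_monoid C\<^esub> iso_class C B"
    using o isomorphic_refl by (auto simp: dec_monoid_def iso_class_def)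
qed

lemma dec_monoid_zero:
  assumes Z: "is_initial C Z"
  shows "\<one>\<^bsub>dec_monoid C\<^esub> = iso_class C Z"
proof (rule equalityI; rule subsetI)
  fix W assume "W \<in> \<one>\<^bsub>dec_monoid C\<^esub>"
  then have W: "is_initial C W" by (simp add: dec_monoid_def)
  obtain f g where fg: "f \<in> Hom C Z W" "g \<in> Hom C W Z"
    using Z W unfolding is_initial_def by blast
  have o: "Z \<in> Obj C" "W \<in> Obj C" using Z W by (auto simp: is_initial_def)
  have "\<exists>!h. h \<in> Hom C Z Z" "\<exists>!h. h \<in> Hom C W W"
    using Z W o by (simp_all add: is_initial_def)
  then have "g \<bullet> f = Idt C Z" "f \<bullet> g = Idt C W"
    using Cmp_Hom[OF fg] Cmp_Hom[OF fg(2,1)] Idt_Hom[OF o(1)] Idt_Hom[OF o(2)] by blast+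
  then have "isomorphic C Z W" using fg isomorphicI by blast
  then show "W \<in> iso_class C Z" using o by (simp add: iso_class_def)
next
  fix W assume "W \<in> iso_class C Z"
  then have W: "W \<in> Obj C" "isomorphic C Z W" by (auto simp: iso_class_def)
  obtain f g where f: "f \<in> Hom C Z W" "g \<in> Hom C W Z" "g \<bullet> f = Idt C Z" "f \<bullet> g = Idt C W"
    using W(2) by (rule isomorphicE)
  have "\<exists>!h. h \<in> Hom C W A" if A: "A \<in> Obj C" for A
  proof -
    obtain h where h: "h \<in> Hom C Z A" using Z A unfolding is_initial_def by blast
    have "k = h \<bullet> g" if k: "k \<in> Hom C W A" for k
    proof -
      have "\<exists>!h. h \<in> Hom C Z A" using Z A by (simp add: is_initial_def)
      then have "k \<bullet> f = h" using h Cmp_Hom[OF f(1) k] by blast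
      then have "h \<bullet> g = k \<bullet> f \<bullet> g" using Cmp_assoc[OF f(2) f(1) k] by simp
      then show ?thesis using f(4) k Cmp_Idt by metis
    qed
    then show ?thesis using h f(2) Cmp_Hom by blast
  qed
  then show "W \<in> \<one>\<^bsub>dec_monoid C\<^esub>"
    using W(1) by (simp add: dec_monoid_def is_initial_def)
qed

end

definition opposite :: "('o, 'm) category_data \<Rightarrow> ('o, 'm) category_data"
  where "opposite C =
    \<lparr>Obj = Obj C, Arr = Arr C, Dom = Cod C, Cod = Dom C, Idt = Idt C, Cmp = (\<lambda>g f. f \<bullet>\<^bsub>C\<^esub> g)\<rparr>"

lemma Hom_opposite: "Hom (opposite C) A B = Hom C B A"
  by (auto simp: Hom_def opposite_def)

lemma opposite_simps:
  "Obj (opposite C) = Obj C" "Arr (opposite C) = Arr C" "Dom (opposite C) = Cod C"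
  "Cod (opposite C) = Dom C" "Idt (opposite C) = Idt C" "g \<bullet>\<^bsub>opposite C\<^esub> f = f \<bullet>\<^bsub>C\<^esub> g"
  by (simp_all add: opposite_def)

lemma is_coproduct2_opposite: "is_coproduct2 (opposite C) A B S i j \<longleftrightarrow> is_product2 C A B S i j"
  by (simp add: is_coproduct2_def is_product2_def Hom_opposite opposite_simps)

lemma is_initial_opposite: "is_initial (opposite C) Z \<longleftrightarrow> is_terminal C Z"
  by (simp add: is_initial_def is_terminal_def Hom_opposite opposite_simps)

lemma isomorphic_opposite: "isomorphic (opposite C) A B \<longleftrightarrow> isomorphic C A B"
  by (auto simp: isomorphic_def Hom_opposite opposite_simps)

context category
begin

lemma category_opposite: "category (opposite C)"
proof
  show "Dom (opposite C) f \<in> Obj (opposite C)" if "f \<in> Arr (opposite C)" for f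
    using that Cod_Obj by (simp add: opposite_simps)
  show "Cod (opposite C) f \<in> Obj (opposite C)" if "f \<in> Arr (opposite C)" for f
    using that Dom_Obj by (simp add: opposite_simps)
qed (simp_all only: Hom_opposite opposite_simps Idt_Hom Cmp_Hom Cmp_Idt Idt_Cmp Cmp_assoc)

lemma dec_semiring_mult:
  assumes "is_product2 C A B P p q"
  shows "iso_class C A \<otimes>\<^bsub>dec_semiring C\<^esub> iso_class C B = iso_class C P"
  using category.dec_monoid_add[OF category_opposite, of A B P p q] assms
  by (simp add: is_coproduct2_opposite dec_monoid_def dec_semiring_def iso_class_def
      isomorphic_opposite opposite_simps)

lemma dec_semiring_one:
  assumes "is_terminal C Z"
  shows "\<one>\<^bsub>dec_semiring C\<^esub> = iso_class C Z"
  using category.dec_monoid_zero[OF category_opposite, of Z] assms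
  by (simp add: is_initial_opposite dec_monoid_def dec_semiring_def iso_class_def
      isomorphic_opposite opposite_simps)

end

text \<open>The Grothendieck group is the universal commutative group under \<open>M\<close>.\<close>

context comm_monoid
begin

lemma groth_equiv: "equiv (carrier G \<times> carrier G) (groth_rel G)"
proof (rule equivI)
  show "groth_rel G \<subseteq> (carrier G \<times> carrier G) \<times> (carrier G \<times> carrier G)"
    by (auto simp: groth_rel_def)
  show "refl_on (carrier G \<times> carrier G) (groth_rel G)"
    by (auto simp: refl_on_def groth_rel_def)
  show "sym (groth_rel G)"
    by (auto simp: sym_def groth_rel_def) metis
  show "trans (groth_rel G)"
  proof (rule transI)
    fix x y z assume xy: "(x, y) \<in> groth_rel G" and yz: "(y, z) \<in> groth_rel G"
    obtain a b c d e f where [simp]: "x = (a, b)" "y = (c, d)" "z = (e, f)"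
      by (metis surj_pair)
    have c: "a \<in> carrier G" "b \<in> carrier G" "c \<in> carrier G" "d \<in> carrier G" "e \<in> carrier G" "f \<in> carrier G"
      using xy yz by (auto simp: groth_rel_def)
    obtain k where k: "k \<in> carrier G" "a \<otimes> d \<otimes> k = c \<otimes> b \<otimes> k"
      using xy by (auto simp: groth_rel_def)
    obtain l where l: "l \<in> carrier G" "c \<otimes> f \<otimes> l = e \<otimes> d \<otimes> l"
      using yz by (auto simp: groth_rel_def)
    have "a \<otimes> f \<otimes> (d \<otimes> k \<otimes> l) = (a \<otimes> d \<otimes> k) \<otimes> (f \<otimes> l)"
      using c k(1) l(1) by (simp add: m_ac)
    also have "\<dots> = (c \<otimes> b \<otimes> k) \<otimes> (f \<otimes> l)" using k by simp
    also have "\<dots> = (c \<otimes> f \<otimes> l) \<otimes> (b \<otimes> k)" using c k(1) l(1) by (simp add: m_ac)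
    also have "\<dots> = (e \<otimes> d \<otimes> l) \<otimes> (b \<otimes> k)" using l by simp
    also have "\<dots> = e \<otimes> b \<otimes> (d \<otimes> k \<otimes> l)" using c k(1) l(1) by (simp add: m_ac)
    finally show "(x, z) \<in> groth_rel G"
      using c k(1) l(1) by (auto simp: groth_rel_def intro!: bexI[of _ "d \<otimes> k \<otimes> l"])
  qed
qed

lemma groth_diff_eq_iff:
  assumes "a \<in> carrier G" "b \<in> carrier G" "c \<in> carrier G" "d \<in> carrier G"
  shows "groth_diff G a b = groth_diff G c d
    \<longleftrightarrow> (\<exists>k\<in>carrier G. a \<otimes> d \<otimes> k = c \<otimes> b \<otimes> k)"
  using assms eq_equiv_class_iff[OF groth_equiv, of "(a, b)" "(c, d)"]
  by (simp add: groth_diff_def groth_rel_def)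

lemma groth_carrierE:
  assumes "X \<in> carrier (groth_group G)"
  obtains a b where "a \<in> carrier G" "b \<in> carrier G" "X = groth_diff G a b"
  using assms by (auto simp: groth_group_def groth_diff_def elim!: quotientE)

lemma groth_diff_closed:
  "a \<in> carrier G \<Longrightarrow> b \<in> carrier G \<Longrightarrow> groth_diff G a b \<in> carrier (groth_group G)"
  by (auto simp: groth_group_def groth_diff_def intro: quotientI)

lemma groth_mult:
  assumes c: "a \<in> carrier G" "b \<in> carrier G" "c \<in> carrier G" "d \<in> carrier G"
  shows "groth_diff G a b \<otimes>\<^bsub>groth_group G\<^esub> groth_diff G c d = groth_diff G (a \<otimes> c) (b \<otimes> d)"
proof -
  let ?f = "\<lambda>(a, b) (c, d). groth_diff G (a \<otimes> c) (b \<otimes> d)"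
  have "congruent2 (groth_rel G) (groth_rel G) ?f"
  proof (rule congruent2_commuteI[OF groth_equiv])
    fix y z :: "'a \<times> 'a" assume "y \<in> carrier G \<times> carrier G" "z \<in> carrier G \<times> carrier G"
    then show "?f y z = ?f z y" by (auto simp: m_comm)
  next
    fix y z w assume yz: "(y, z) \<in> groth_rel G" and w: "w \<in> carrier G \<times> carrier G"
    obtain p q r s t u where [simp]: "y = (p, q)" "z = (r, s)" "w = (t, u)"
      by (metis surj_pair)
    have c: "p \<in> carrier G" "q \<in> carrier G" "r \<in> carrier G" "s \<in> carrier G" "t \<in> carrier G" "u \<in> carrier G"
      using yz w by (auto simp: groth_rel_def)
    obtain k where k: "k \<in> carrier G" "p \<otimes> s \<otimes> k = r \<otimes> q \<otimes> k"
      using yz by (auto simp: groth_rel_def)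
    have "(t \<otimes> p) \<otimes> (u \<otimes> s) \<otimes> k = (p \<otimes> s \<otimes> k) \<otimes> (t \<otimes> u)" using c k(1) by (simp add: m_ac)
    also have "\<dots> = (r \<otimes> q \<otimes> k) \<otimes> (t \<otimes> u)" using k by simp
    also have "\<dots> = (t \<otimes> r) \<otimes> (u \<otimes> q) \<otimes> k" using c k(1) by (simp add: m_ac)
    finally show "?f w y = ?f w z" using c k(1) by (auto simp: groth_diff_eq_iff)
  qed
  from UN_equiv_class2[OF groth_equiv groth_equiv this, of "(a, b)" "(c, d)"] c
  show ?thesis by (simp add: groth_group_def groth_diff_def case_prod_unfold)
qed

lemma groth_comm_group: "comm_group (groth_group G)"
proof (rule comm_groupI)
  have one: "\<one>\<^bsub>groth_group G\<^esub> = groth_diff G \<one> \<one>" by (simp add: groth_group_def)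
  show "\<one>\<^bsub>groth_group G\<^esub> \<in> carrier (groth_group G)" by (simp add: one groth_diff_closed)
  fix X Y Z
  assume X: "X \<in> carrier (groth_group G)"
  then obtain a b where a: "a \<in> carrier G" "b \<in> carrier G" "X = groth_diff G a b" by (rule groth_carrierE)
  show "\<one>\<^bsub>groth_group G\<^esub> \<otimes>\<^bsub>groth_group G\<^esub> X = X" using a by (simp add: one groth_mult)
  have "groth_diff G b a \<otimes>\<^bsub>groth_group G\<^esub> X = \<one>\<^bsub>groth_group G\<^esub>"
    using a by (auto simp: one groth_mult groth_diff_eq_iff m_ac intro!: bexI[of _ \<one>])
  then show "\<exists>Y\<in>carrier (groth_group G). Y \<otimes>\<^bsub>groth_group G\<^esub> X = \<one>\<^bsub>groth_group G\<^esub>"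
    using a groth_diff_closed by blast
  assume "Y \<in> carrier (groth_group G)"
  then obtain c d where c: "c \<in> carrier G" "d \<in> carrier G" "Y = groth_diff G c d" by (rule groth_carrierE)
  show "X \<otimes>\<^bsub>groth_group G\<^esub> Y \<in> carrier (groth_group G)" using a c by (simp add: groth_mult groth_diff_closed)
  show "X \<otimes>\<^bsub>groth_group G\<^esub> Y = Y \<otimes>\<^bsub>groth_group G\<^esub> X" using a c by (simp add: groth_mult m_comm)
  assume "Z \<in> carrier (groth_group G)"
  then obtain e f where e: "e \<in> carrier G" "f \<in> carrier G" "Z = groth_diff G e f" by (rule groth_carrierE)
  show "X \<otimes>\<^bsub>groth_group G\<^esub> Y \<otimes>\<^bsub>groth_group G\<^esub> Z = X \<otimes>\<^bsub>groth_group G\<^esub> (Y \<otimes>\<^bsub>groth_group G\<^esub> Z)"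
    using a c e by (simp add: groth_mult m_assoc)
qed

lemma groth_map_hom: "groth_map G \<in> hom G (groth_group G)"
  by (auto simp: hom_def groth_map_def groth_diff_closed groth_mult)

lemma groth_ext_diff:
  assumes H: "comm_group H" and f: "f \<in> hom G H" and c: "a \<in> carrier G" "b \<in> carrier G"
  shows "groth_ext H f (groth_diff G a b) = f a \<otimes>\<^bsub>H\<^esub> inv\<^bsub>H\<^esub> f b"
proof -
  interpret H: comm_group H by fact
  have fc [simp]: "f x \<in> carrier H" if "x \<in> carrier G" for x using f that by (auto simp: hom_def)
  have fm: "f (x \<otimes> y) = f x \<otimes>\<^bsub>H\<^esub> f y" if "x \<in> carrier G" "y \<in> carrier G" for x y
    using f that by (auto simp: hom_def)
  have eq: "f p \<otimes>\<^bsub>H\<^esub> inv\<^bsub>H\<^esub> f q = f a \<otimes>\<^bsub>H\<^esub> inv\<^bsub>H\<^esub> f b"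
    if pq: "(p, q) \<in> groth_diff G a b" for p q
  proof -
    obtain k where k: "p \<in> carrier G" "q \<in> carrier G" "k \<in> carrier G" "a \<otimes> q \<otimes> k = p \<otimes> b \<otimes> k"
      using pq by (auto simp: groth_diff_def groth_rel_def)
    then have "f a \<otimes>\<^bsub>H\<^esub> f q \<otimes>\<^bsub>H\<^esub> f k = f p \<otimes>\<^bsub>H\<^esub> f b \<otimes>\<^bsub>H\<^esub> f k"
      using c by (simp flip: fm)
    then have e: "f a \<otimes>\<^bsub>H\<^esub> f q = f p \<otimes>\<^bsub>H\<^esub> f b" using k c by (simp add: H.right_cancel)
    have fs: "f p \<in> carrier H" "f q \<in> carrier H" "f a \<in> carrier H" "f b \<in> carrier H"
      using k(1,2) c by simp_all
    have *: "x \<otimes>\<^bsub>H\<^esub> inv\<^bsub>H\<^esub> y = z \<otimes>\<^bsub>H\<^esub> inv\<^bsub>H\<^esub> w"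
      if "x \<in> carrier H" "y \<in> carrier H" "z \<in> carrier H" "w \<in> carrier H"
        "z \<otimes>\<^bsub>H\<^esub> y = x \<otimes>\<^bsub>H\<^esub> w" for x y z w
    proof -
      have "x = z \<otimes>\<^bsub>H\<^esub> y \<otimes>\<^bsub>H\<^esub> inv\<^bsub>H\<^esub> w"
        unfolding that(5) using that(1-4) by (simp add: H.m_assoc)
      also have "\<dots> = z \<otimes>\<^bsub>H\<^esub> inv\<^bsub>H\<^esub> w \<otimes>\<^bsub>H\<^esub> y"
        using that(1-4) by (simp add: H.m_ac)
      finally show ?thesis using that(1-4) by (simp add: H.m_assoc)
    qed
    show ?thesis by (rule *[OF fs(1,2,3,4) e])
  qed
  have mem: "(a, b) \<in> groth_diff G a b"
    using c by (auto simp: groth_diff_def groth_rel_def)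
  have "(\<lambda>(p, q). f p \<otimes>\<^bsub>H\<^esub> inv\<^bsub>H\<^esub> f q) ` groth_diff G a b
      = (\<lambda>_. f a \<otimes>\<^bsub>H\<^esub> inv\<^bsub>H\<^esub> f b) ` groth_diff G a b"
    by (rule image_cong[OF refl]) (clarify, rule eq)
  also have "\<dots> = {f a \<otimes>\<^bsub>H\<^esub> inv\<^bsub>H\<^esub> f b}"
    using mem by (simp add: image_constant)
  finally show ?thesis by (simp only: groth_ext_def the_elem_eq)
qed

lemma groth_universal:
  assumes H: "comm_group H" and f: "f \<in> hom G H"
  shows "groth_ext H f \<in> hom (groth_group G) H"
    and "x \<in> carrier G \<Longrightarrow> groth_ext H f (groth_map G x) = f x"
    and "h \<in> hom (groth_group G) H \<Longrightarrow> (\<And>x. x \<in> carrier G \<Longrightarrow> h (groth_map G x) = f x)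
      \<Longrightarrow> X \<in> carrier (groth_group G) \<Longrightarrow> h X = groth_ext H f X"
proof -
  interpret H: comm_group H by fact
  interpret K: comm_group "groth_group G" by (rule groth_comm_group)
  have fc [simp]: "f x \<in> carrier H" if "x \<in> carrier G" for x using f that by (auto simp: hom_def)
  have fm: "f (x \<otimes> y) = f x \<otimes>\<^bsub>H\<^esub> f y" if "x \<in> carrier G" "y \<in> carrier G" for x y
    using f that by (auto simp: hom_def)
  have f1: "f \<one> = \<one>\<^bsub>H\<^esub>"
    by (metis H.l_cancel_one' fc fm l_one one_closed)
  show 1: "groth_ext H f \<in> hom (groth_group G) H"
  proof (rule homI)
    fix X assume "X \<in> carrier (groth_group G)"
    then obtain a b where a: "a \<in> carrier G" "b \<in> carrier G" "X = groth_diff G a b" by (rule groth_carrierE)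
    then show "groth_ext H f X \<in> carrier H" by (simp add: groth_ext_diff[OF H f])
    fix Y assume "Y \<in> carrier (groth_group G)"
    then obtain c d where c: "c \<in> carrier G" "d \<in> carrier G" "Y = groth_diff G c d" by (rule groth_carrierE)
    show "groth_ext H f (X \<otimes>\<^bsub>groth_group G\<^esub> Y) = groth_ext H f X \<otimes>\<^bsub>H\<^esub> groth_ext H f Y"
      using a c by (simp add: groth_mult groth_ext_diff[OF H f] fm H.inv_mult H.m_ac)
  qed
  show 2: "groth_ext H f (groth_map G x) = f x" if "x \<in> carrier G" for x
    using that by (simp add: groth_map_def groth_ext_diff[OF H f] f1)
  assume h: "h \<in> hom (groth_group G) H" and hf: "\<And>x. x \<in> carrier G \<Longrightarrow> h (groth_map G x) = f x"
    and "X \<in> carrier (groth_group G)"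
  from this(3) obtain a b where a: "a \<in> carrier G" "b \<in> carrier G" "X = groth_diff G a b" by (rule groth_carrierE)
  have mc: "groth_map G b \<in> carrier (groth_group G)" using a by (simp add: groth_map_def groth_diff_closed)
  have Xc: "X \<in> carrier (groth_group G)" using a groth_diff_closed by simp
  have "X \<otimes>\<^bsub>groth_group G\<^esub> groth_map G b = groth_map G a"
    using a by (auto simp: groth_map_def groth_mult groth_diff_eq_iff m_ac intro!: bexI[of _ \<one>])
  then have "h X \<otimes>\<^bsub>H\<^esub> f b = f a" using h hf a Xc mc by (metis hom_mult)
  moreover have "h X \<in> carrier H" using h Xc by (auto simp: hom_def)
  ultimately have "h X = f a \<otimes>\<^bsub>H\<^esub> inv\<^bsub>H\<^esub> f b" using a H.inv_solve_right[of "h X" "f a" "f b"] by simp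
  then show "h X = groth_ext H f X" using a by (simp add: groth_ext_diff[OF H f])
qed

end

end

theory Submission
  imports Defs "HOL-Algebra.Divisibility"
begin

text \<open>The monoid of isomorphism classes is free on the classes of connected objects (Krull--Schmidt),
  hence cancellative, so it embeds in its Grothendieck group. In a locally finite extensive category
  the decompositions exist because an object with \<open>n\<close> non-initial summands has at least
  \<open>2 ^ n\<close> maps to its double, and a non-initial object without proper decomposition is connected.
  Since \<open>Hom\<close> turns coproducts in its first argument into products, the numbers
  \<open>#Hom (C\<^sub>i, A)\<close> determine all \<open>#Hom (X, A)\<close>, hence \<open>A\<close> if the category is combinatorial.\<close>

section \<open>Grothendieck groups and rings\<close>

text \<open>Formal differences are compared only up to a common summand, and this slack is what
  cancellation removes. Extensivity serves the existence of decompositions alone: hypothesis (a) is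
  reduced to (b), and uniqueness rests on the bijection that defines connectedness. The double is a
  test object. Each summand of \<open>A\<close> maps to \<open>A\<close>, hence to either copy of
  it, and the two maps differ unless the summand is initial, because coprojections are disjoint and
  the initial object is strict. Finite hom-sets then bound the number of summands. Since no
  coproduct is canonical, the argument runs in the monoid of classes as far as possible, with lists
  of classes in place of families of objects. Injectivity of the counts on the whole Grothendieck
  group costs nothing beyond injectivity on the monoid, since an equality of differences rearranges
  to an equality of sums.\<close>

lemma add_monoid_groth_ring: "add_monoid (groth_ring R) = groth_group (add_monoid R)"
  by (simp add: groth_ring_def groth_group_def)

section \<open>The ring of formal differences of a commutative semi-ring\<close>

locale comm_semiring = semiring R + comm_monoid R for R (structure)
begin

text \<open>Commutativity of both operations makes the formula symmetric in its two factors, so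
  independence of the representative has to be checked in one factor only.\<close>

lemma groth_ring_mult:
  assumes c: "a \<in> carrier R" "b \<in> carrier R" "c \<in> carrier R" "d \<in> carrier R"
  shows "groth_diff (add_monoid R) a b \<otimes>\<^bsub>groth_ring R\<^esub> groth_diff (add_monoid R) c d
    = groth_diff (add_monoid R) (a \<otimes> c \<oplus> b \<otimes> d) (a \<otimes> d \<oplus> b \<otimes> c)"
proof -
  let ?f = "\<lambda>(a, b) (c, d). groth_diff (add_monoid R) (a \<otimes> c \<oplus> b \<otimes> d) (a \<otimes> d \<oplus> b \<otimes> c)"
  have "congruent2 (groth_rel (add_monoid R)) (groth_rel (add_monoid R)) ?f"
  proof (rule congruent2_commuteI[OF add.groth_equiv])
    fix y z :: "'a \<times> 'a" assume "y \<in> carrier R \<times> carrier R" "z \<in> carrier R \<times> carrier R"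
    then show "?f y z = ?f z y" by (auto simp: m_comm a_comm)
  next
    fix y z w assume yz: "(y, z) \<in> groth_rel (add_monoid R)" and w: "w \<in> carrier R \<times> carrier R"
    obtain p q r s t u where [simp]: "y = (p, q)" "z = (r, s)" "w = (t, u)"
      by (metis surj_pair)
    have c: "p \<in> carrier R" "q \<in> carrier R" "r \<in> carrier R" "s \<in> carrier R" "t \<in> carrier R" "u \<in> carrier R"
      using yz w by (auto simp: groth_rel_def)
    obtain k where k: "k \<in> carrier R" "p \<oplus> s \<oplus> k = r \<oplus> q \<oplus> k"
      using yz by (auto simp: groth_rel_def)
    \<comment> \<open>The relation with slack \<open>k\<close> is multiplied by \<open>t\<close>
      and, with its sides exchanged, by \<open>u\<close>. Adding the two leaves one copy of
      \<open>k\<close> with each multiplier, hence this slack.\<close>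
    let ?k = "t \<otimes> k \<oplus> u \<otimes> k"
    have "(t \<otimes> p \<oplus> u \<otimes> q) \<oplus> (t \<otimes> s \<oplus> u \<otimes> r) \<oplus> ?k
        = t \<otimes> (p \<oplus> s \<oplus> k) \<oplus> u \<otimes> (r \<oplus> q \<oplus> k)"
      using c k(1) by (simp add: r_distr a_ac)
    also have "\<dots> = t \<otimes> (r \<oplus> q \<oplus> k) \<oplus> u \<otimes> (p \<oplus> s \<oplus> k)" using k(2) by simp
    also have "\<dots> = (t \<otimes> r \<oplus> u \<otimes> s) \<oplus> (t \<otimes> q \<oplus> u \<otimes> p) \<oplus> ?k"
      using c k(1) by (simp add: r_distr a_ac)
    finally show "?f w y = ?f w z"
      using c k(1) by (auto simp: add.groth_diff_eq_iff intro!: bexI[of _ ?k])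
  qed
  from UN_equiv_class2[OF add.groth_equiv add.groth_equiv this, of "(a, b)" "(c, d)"] c
  show ?thesis by (simp add: groth_ring_def groth_diff_def case_prod_unfold)
qed

lemma groth_ring_carrierE:
  assumes "X \<in> carrier (groth_ring R)"
  obtains a b where "a \<in> carrier R" "b \<in> carrier R" "X = groth_diff (add_monoid R) a b"
  using assms by (auto simp: groth_ring_def elim: add.groth_carrierE)

lemma groth_ring_closed:
  "a \<in> carrier R \<Longrightarrow> b \<in> carrier R \<Longrightarrow> groth_diff (add_monoid R) a b \<in> carrier (groth_ring R)"
  by (simp add: groth_ring_def add.groth_diff_closed)

lemma groth_ring_add:
  assumes "a \<in> carrier R" "b \<in> carrier R" "c \<in> carrier R" "d \<in> carrier R"
  shows "groth_diff (add_monoid R) a b \<oplus>\<^bsub>groth_ring R\<^esub> groth_diff (add_monoid R) c d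
    = groth_diff (add_monoid R) (a \<oplus> c) (b \<oplus> d)"
  using add.groth_mult[OF assms] by (simp add: groth_ring_def)

lemma groth_ring_one: "\<one>\<^bsub>groth_ring R\<^esub> = groth_diff (add_monoid R) \<one> \<zero>"
  by (simp add: groth_ring_def)

lemma groth_ring_cring: "cring (groth_ring R)"
proof (rule cringI)
  show "abelian_group (groth_ring R)"
    by (rule comm_group_abelian_groupI) (simp only: add_monoid_groth_ring add.groth_comm_group)
  show "comm_monoid (groth_ring R)"
  proof (rule comm_monoidI)
    show "\<one>\<^bsub>groth_ring R\<^esub> \<in> carrier (groth_ring R)" by (simp add: groth_ring_one groth_ring_closed)
    fix X Y Z
    assume "X \<in> carrier (groth_ring R)"
    then obtain a b where a: "a \<in> carrier R" "b \<in> carrier R" "X = groth_diff (add_monoid R) a b"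
      by (rule groth_ring_carrierE)
    show "\<one>\<^bsub>groth_ring R\<^esub> \<otimes>\<^bsub>groth_ring R\<^esub> X = X"
      using a by (simp add: groth_ring_one groth_ring_mult)
    assume "Y \<in> carrier (groth_ring R)"
    then obtain c d where c: "c \<in> carrier R" "d \<in> carrier R" "Y = groth_diff (add_monoid R) c d"
      by (rule groth_ring_carrierE)
    show "X \<otimes>\<^bsub>groth_ring R\<^esub> Y \<in> carrier (groth_ring R)"
      using a c by (simp add: groth_ring_mult groth_ring_closed)
    show "X \<otimes>\<^bsub>groth_ring R\<^esub> Y = Y \<otimes>\<^bsub>groth_ring R\<^esub> X"
      using a c by (simp add: groth_ring_mult m_comm a_comm)
    assume "Z \<in> carrier (groth_ring R)"
    then obtain e f where e: "e \<in> carrier R" "f \<in> carrier R" "Z = groth_diff (add_monoid R) e f"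
      by (rule groth_ring_carrierE)
    show "X \<otimes>\<^bsub>groth_ring R\<^esub> Y \<otimes>\<^bsub>groth_ring R\<^esub> Z = X \<otimes>\<^bsub>groth_ring R\<^esub> (Y \<otimes>\<^bsub>groth_ring R\<^esub> Z)"
      using a c e by (simp add: groth_ring_mult l_distr r_distr m_assoc a_ac)
  qed
next
  fix X Y Z assume "X \<in> carrier (groth_ring R)" "Y \<in> carrier (groth_ring R)" "Z \<in> carrier (groth_ring R)"
  then obtain a b c d e f where "a \<in> carrier R" "b \<in> carrier R" "c \<in> carrier R" "d \<in> carrier R"
    "e \<in> carrier R" "f \<in> carrier R" and "X = groth_diff (add_monoid R) a b"
    "Y = groth_diff (add_monoid R) c d" "Z = groth_diff (add_monoid R) e f"
    by (metis groth_ring_carrierE)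
  then show "(X \<oplus>\<^bsub>groth_ring R\<^esub> Y) \<otimes>\<^bsub>groth_ring R\<^esub> Z
      = X \<otimes>\<^bsub>groth_ring R\<^esub> Z \<oplus>\<^bsub>groth_ring R\<^esub> Y \<otimes>\<^bsub>groth_ring R\<^esub> Z"
    by (simp add: groth_ring_mult groth_ring_add l_distr a_ac)
qed

lemma groth_map_ring_hom: "groth_map (add_monoid R) \<in> ring_hom R (groth_ring R)"
  by (rule ring_hom_memI)
    (simp_all add: groth_map_def groth_ring_closed groth_ring_mult groth_ring_add groth_ring_one)

text \<open>The product of formal differences is modelled on the expansion of
  \<open>(f a - f b) * (f c - f d)\<close>, so multiplicativity passes to the extension. That
  \<open>f\<close> preserves zero follows from additivity, since an idempotent of a group is its
  unit.\<close>

lemma groth_ext_ring_hom: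
  assumes S: "cring S" and add: "f \<in> hom (add_monoid R) (add_monoid S)"
    and mult: "\<And>x y. x \<in> carrier R \<Longrightarrow> y \<in> carrier R \<Longrightarrow> f (x \<otimes> y) = f x \<otimes>\<^bsub>S\<^esub> f y"
    and one: "f \<one> = \<one>\<^bsub>S\<^esub>"
  shows "groth_ext (add_monoid S) f \<in> ring_hom (groth_ring R) S"
proof -
  interpret S: cring S by fact
  have fc [simp]: "f x \<in> carrier S" if "x \<in> carrier R" for x using add that by (auto simp: hom_def)
  have fa: "f (x \<oplus> y) = f x \<oplus>\<^bsub>S\<^esub> f y" if "x \<in> carrier R" "y \<in> carrier R" for x y
    using add that by (auto simp: hom_def)
  have "f \<zero> \<oplus>\<^bsub>S\<^esub> f \<zero> = f \<zero>" using fa[of \<zero> \<zero>] by simp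
  then have f0: "f \<zero> = \<zero>\<^bsub>S\<^esub>" using S.add.l_cancel_one' fc zero_closed by metis
  have ext: "groth_ext (add_monoid S) f (groth_diff (add_monoid R) a b) = f a \<ominus>\<^bsub>S\<^esub> f b"
    if "a \<in> carrier R" "b \<in> carrier R" for a b
    using add.groth_ext_diff[OF S.a_comm_group add that] by (simp add: a_minus_def a_inv_def)
  show ?thesis
  proof (rule ring_hom_memI)
    fix X assume "X \<in> carrier (groth_ring R)"
    then obtain a b where a: "a \<in> carrier R" "b \<in> carrier R" "X = groth_diff (add_monoid R) a b"
      by (rule groth_ring_carrierE)
    then show "groth_ext (add_monoid S) f X \<in> carrier S" by (simp add: ext)
    fix Y assume "Y \<in> carrier (groth_ring R)"
    then obtain c d where c: "c \<in> carrier R" "d \<in> carrier R" "Y = groth_diff (add_monoid R) c d"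
      by (rule groth_ring_carrierE)
    show "groth_ext (add_monoid S) f (X \<otimes>\<^bsub>groth_ring R\<^esub> Y)
        = groth_ext (add_monoid S) f X \<otimes>\<^bsub>S\<^esub> groth_ext (add_monoid S) f Y"
      using a c by (simp add: groth_ring_mult ext fa mult S.minus_eq S.l_distr S.r_distr
          S.minus_add S.l_minus S.r_minus S.a_ac)
    show "groth_ext (add_monoid S) f (X \<oplus>\<^bsub>groth_ring R\<^esub> Y)
        = groth_ext (add_monoid S) f X \<oplus>\<^bsub>S\<^esub> groth_ext (add_monoid S) f Y"
      using a c by (simp add: groth_ring_add ext fa S.minus_eq S.minus_add S.a_ac)
  next
    show "groth_ext (add_monoid S) f \<one>\<^bsub>groth_ring R\<^esub> = \<one>\<^bsub>S\<^esub>"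
      by (simp add: groth_ring_one ext one f0 S.minus_eq)
  qed
qed

end

section \<open>Products of commutative groups and of commutative rings\<close>

lemma add_monoid_product_ring:
  "add_monoid (product_ring I R) = product_group I (\<lambda>i. add_monoid (R i))"
  by (simp add: product_ring_def product_group_def)

lemma comm_group_product_group:
  assumes "\<And>i. i \<in> I \<Longrightarrow> comm_group (G i)"
  shows "comm_group (product_group I G)"
proof (rule group.group_comm_groupI)
  show "group (product_group I G)" using assms by (simp add: comm_group.axioms)
  fix x y assume x: "x \<in> carrier (product_group I G)" and y: "y \<in> carrier (product_group I G)"
  have "x i \<otimes>\<^bsub>G i\<^esub> y i = y i \<otimes>\<^bsub>G i\<^esub> x i" if "i \<in> I" for i
    using x y that assms[OF that] by (auto intro!: comm_monoid.m_comm simp: comm_group_def)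
  then show "x \<otimes>\<^bsub>product_group I G\<^esub> y = y \<otimes>\<^bsub>product_group I G\<^esub> x"
    by (simp cong: restrict_cong)
qed

lemma product_ring_cring:
  assumes "\<And>i. i \<in> I \<Longrightarrow> cring (R i)"
  shows "cring (product_ring I R)"
proof (rule cringI)
  have "comm_group (add_monoid (R i))" if "i \<in> I" for i
    using assms[OF that] by (simp add: cring_def ring_def abelian_group.a_comm_group)
  then have "comm_group (product_group I (\<lambda>i. add_monoid (R i)))"
    by (rule comm_group_product_group)
  then show "abelian_group (product_ring I R)"
    by (intro comm_group_abelian_groupI) (simp only: add_monoid_product_ring)
  show "comm_monoid (product_ring I R)"
  proof (rule comm_monoidI)
    fix x assume x: "x \<in> carrier (product_ring I R)"
    \<comment> \<open>Elements of the carrier are extensional: off \<open>I\<close> both sides are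
      \<open>undefined\<close>, which settles the indices that the ring laws do not reach.\<close>
    then have "(\<one>\<^bsub>product_ring I R\<^esub> \<otimes>\<^bsub>product_ring I R\<^esub> x) i = x i" for i
      using cring.cring_simprules(12)[OF assms, of i "x i"]
      by (cases "i \<in> I") (auto simp: product_ring_def PiE_iff extensional_def)
    then show "\<one>\<^bsub>product_ring I R\<^esub> \<otimes>\<^bsub>product_ring I R\<^esub> x = x" by (rule ext)
  qed (use assms in \<open>auto simp: product_ring_def PiE_iff cring.cring_simprules intro!: restrict_ext\<close>)
next
  fix x y z
  assume "x \<in> carrier (product_ring I R)" "y \<in> carrier (product_ring I R)" "z \<in> carrier (product_ring I R)"
  then show "(x \<oplus>\<^bsub>product_ring I R\<^esub> y) \<otimes>\<^bsub>product_ring I R\<^esub> z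
      = x \<otimes>\<^bsub>product_ring I R\<^esub> z \<oplus>\<^bsub>product_ring I R\<^esub> y \<otimes>\<^bsub>product_ring I R\<^esub> z"
    using assms by (auto simp: product_ring_def PiE_iff cring.cring_simprules intro!: restrict_ext)
qed

text \<open>Inverses in \<open>H\<close> turn an equality of differences into one between
  \<open>f a\<close>, \<open>f d\<close> combined and \<open>f c\<close>, \<open>f b\<close>
  combined, that is, between values of \<open>f\<close>. Injectivity on the monoid therefore
  suffices, and the formal differences agree with slack \<open>\<one>\<close>.\<close>

lemma (in comm_monoid) groth_ext_inj:
  assumes H: "comm_group H" and f: "f \<in> hom G H" and inj: "inj_on f (carrier G)"
  shows "inj_on (groth_ext H f) (carrier (groth_group G))"
proof (rule inj_onI)
  interpret H: comm_group H by fact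
  fix X Y
  assume "X \<in> carrier (groth_group G)" "Y \<in> carrier (groth_group G)"
    and e: "groth_ext H f X = groth_ext H f Y"
  then obtain a b c d where a: "a \<in> carrier G" "b \<in> carrier G" "X = groth_diff G a b"
    and c: "c \<in> carrier G" "d \<in> carrier G" "Y = groth_diff G c d"
    by (metis groth_carrierE)
  have fc: "f x \<in> carrier H" if "x \<in> carrier G" for x using f that by (auto simp: hom_def)
  note fs = fc[OF a(1)] fc[OF a(2)] fc[OF c(1)] fc[OF c(2)]
  have eq: "f a \<otimes>\<^bsub>H\<^esub> inv\<^bsub>H\<^esub> f b = f c \<otimes>\<^bsub>H\<^esub> inv\<^bsub>H\<^esub> f d"
    using e a c by (simp add: groth_ext_diff[OF H f])
  have "f a \<otimes>\<^bsub>H\<^esub> f d = f a \<otimes>\<^bsub>H\<^esub> inv\<^bsub>H\<^esub> f b \<otimes>\<^bsub>H\<^esub> (f b \<otimes>\<^bsub>H\<^esub> f d)"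
    using fs by (simp add: H.m_assoc H.inv_solve_left)
  also have "\<dots> = f c \<otimes>\<^bsub>H\<^esub> (inv\<^bsub>H\<^esub> f d \<otimes>\<^bsub>H\<^esub> f d) \<otimes>\<^bsub>H\<^esub> f b"
    unfolding eq using fs by (simp add: H.m_ac del: H.l_inv H.r_inv)
  also have "\<dots> = f c \<otimes>\<^bsub>H\<^esub> f b" using fs by simp
  finally have "f (a \<otimes> d) = f (c \<otimes> b)" using f a c by (simp add: hom_mult)
  then have "a \<otimes> d = c \<otimes> b" using inj a c by (simp add: inj_on_eq_iff)
  then show "X = Y" using a c by (auto simp: groth_diff_eq_iff intro!: bexI[of _ \<one>])
qed

text \<open>Equal images give an equation up to a common summand \<open>k\<close>; cancelling
  \<open>k\<close> is all that is asked of the monoid.\<close>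

lemma (in comm_monoid) groth_map_inj:
  assumes "\<And>x y z. x \<in> carrier G \<Longrightarrow> y \<in> carrier G \<Longrightarrow> z \<in> carrier G
    \<Longrightarrow> x \<otimes> z = y \<otimes> z \<Longrightarrow> x = y"
  shows "inj_on (groth_map G) (carrier G)"
proof (rule inj_onI)
  fix x y assume xy: "x \<in> carrier G" "y \<in> carrier G" and "groth_map G x = groth_map G y"
  then obtain k where "k \<in> carrier G" "x \<otimes> k = y \<otimes> k"
    by (auto simp: groth_map_def groth_diff_eq_iff)
  then show "x = y" using assms xy by blast
qed

section \<open>Isomorphism classes and binary coproducts\<close>

text \<open>Serves to unpack the definition of connectedness, where the disjoint union of two
  hom-sets is awkward to handle directly.\<close>

lemma inj_on_case_sum_iff:
  "inj_on (case_sum f g) (A <+> B) \<longleftrightarrow>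
    inj_on f A \<and> inj_on g B \<and> (\<forall>a\<in>A. \<forall>b\<in>B. f a \<noteq> g b)" (is "?l = ?r")
proof
  assume l: ?l
  have "x = y" if "x \<in> A" "y \<in> A" "f x = f y" for x y
    using inj_onD[OF l, of "Inl x" "Inl y"] that by (simp add: InlI InrI)
  moreover have "x = y" if "x \<in> B" "y \<in> B" "g x = g y" for x y
    using inj_onD[OF l, of "Inr x" "Inr y"] that by (simp add: InlI InrI)
  moreover have "f x \<noteq> g y" if "x \<in> A" "y \<in> B" for x y
    using inj_onD[OF l, of "Inl x" "Inr y"] that by auto
  ultimately show ?r unfolding inj_on_def by blast
next
  assume r: ?r
  show ?l
  proof (rule inj_onI)
    fix x y assume "x \<in> A <+> B" "y \<in> A <+> B" "case_sum f g x = case_sum f g y"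
    then show "x = y" using r by (cases x; cases y) (auto simp: inj_on_def, metis)
  qed
qed

context category
begin

lemma isomorphic_sym: "isomorphic C A B \<Longrightarrow> isomorphic C B A"
  by (auto simp: isomorphic_def)

lemma cancel_left:
  assumes "f \<in> Hom C A B" "h \<in> Hom C B D" "k \<in> Hom C D B" "k \<bullet> h = Idt C B"
  shows "k \<bullet> h \<bullet> f = f"
  using Cmp_assoc[OF assms(1-3)] assms(4) Idt_Cmp[OF assms(1)] by simp

lemma cancel_right:
  assumes "f \<in> Hom C A B" "h \<in> Hom C A D" "k \<in> Hom C D A" "k \<bullet> h = Idt C A"
  shows "(f \<bullet> k) \<bullet> h = f"
  using Cmp_assoc[OF assms(2,3,1)] assms(4) Cmp_Idt[OF assms(1)] by simp

lemma isomorphic_trans: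
  assumes "isomorphic C A B" "isomorphic C B D"
  shows "isomorphic C A D"
proof -
  obtain f g where f: "f \<in> Hom C A B" "g \<in> Hom C B A" "g \<bullet> f = Idt C A" "f \<bullet> g = Idt C B"
    using assms(1) by (rule isomorphicE)
  obtain h k where h: "h \<in> Hom C B D" "k \<in> Hom C D B" "k \<bullet> h = Idt C B" "h \<bullet> k = Idt C D"
    using assms(2) by (rule isomorphicE)
  have hf: "h \<bullet> f \<in> Hom C A D" and gk: "g \<bullet> k \<in> Hom C D A" using f h Cmp_Hom by blast+
  have "(g \<bullet> k) \<bullet> h \<bullet> f = g \<bullet> f"
    using Cmp_assoc[OF hf h(2) f(2)] cancel_left[OF f(1) h(1-3)] by simp
  moreover have "(h \<bullet> f) \<bullet> g \<bullet> k = h \<bullet> k"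
    using Cmp_assoc[OF gk f(1) h(1)] cancel_left[OF h(2) f(2,1,4)] by simp
  ultimately show ?thesis using isomorphicI[OF hf gk] f(3) h(4) by simp
qed

lemma iso_class_eq_iff:
  assumes "A \<in> Obj C" "B \<in> Obj C"
  shows "iso_class C A = iso_class C B \<longleftrightarrow> isomorphic C A B"
  using assms isomorphic_refl isomorphic_sym isomorphic_trans unfolding iso_class_def by blast

lemma iso_class_self: "A \<in> Obj C \<Longrightarrow> A \<in> iso_class C A"
  by (simp add: iso_class_def isomorphic_refl)

lemma iso_class_eqI: "A \<in> iso_class C B \<Longrightarrow> iso_class C A = iso_class C B"
  using isomorphic_sym isomorphic_trans unfolding iso_class_def by blast

text \<open>Sums of classes are formed from arbitrary members, so any member must be able to serve
  as the representative.\<close>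

lemma dec_carrier_memE:
  assumes "x \<in> carrier (dec_monoid C)" "A \<in> x"
  shows "A \<in> Obj C" "x = iso_class C A"
proof -
  obtain B where B: "B \<in> Obj C" "x = iso_class C B"
    using assms(1) by (auto simp: dec_monoid_def)
  then show "A \<in> Obj C" "x = iso_class C A"
    using assms(2) iso_class_eqI by (auto simp: iso_class_def)
qed

lemma dec_carrierE:
  assumes "x \<in> carrier (dec_monoid C)"
  obtains A where "A \<in> Obj C" "x = iso_class C A"
  using assms by (auto simp: dec_monoid_def)

lemma iso_class_in_dec: "A \<in> Obj C \<Longrightarrow> iso_class C A \<in> carrier (dec_monoid C)"
  by (simp add: dec_monoid_def)

lemma coproduct2_obj:
  assumes "is_coproduct2 C A B S i j"
  shows "A \<in> Obj C" "B \<in> Obj C" "S \<in> Obj C" "i \<in> Hom C A S" "j \<in> Hom C B S"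
  using assms by (auto simp: is_coproduct2_def)

lemma coproduct2_copair:
  assumes "is_coproduct2 C A B S i j" "f \<in> Hom C A T" "g \<in> Hom C B T"
  obtains u where "u \<in> Hom C S T" "u \<bullet> i = f" "u \<bullet> j = g"
  using assms HomD[OF assms(2)] unfolding is_coproduct2_def by metis

lemma coproduct2_eqI:
  assumes S: "is_coproduct2 C A B S i j" and u: "u \<in> Hom C S T" and v: "v \<in> Hom C S T"
    and "u \<bullet> i = v \<bullet> i" "u \<bullet> j = v \<bullet> j"
  shows "u = v"
proof -
  have "v \<bullet> i \<in> Hom C A T" "v \<bullet> j \<in> Hom C B T"
    using coproduct2_obj[OF S] v Cmp_Hom by blast+
  then have "\<exists>!w. w \<in> Hom C S T \<and> w \<bullet> i = v \<bullet> i \<and> w \<bullet> j = v \<bullet> j"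
    using S HomD[OF u] unfolding is_coproduct2_def by blast
  then show ?thesis using assms by blast
qed

lemma coproduct2I:
  assumes "i \<in> Hom C A S" "j \<in> Hom C B S"
    and "\<And>T f g. f \<in> Hom C A T \<Longrightarrow> g \<in> Hom C B T \<Longrightarrow> \<exists>u. u \<in> Hom C S T \<and> u \<bullet> i = f \<and> u \<bullet> j = g"
    and "\<And>T u v. u \<in> Hom C S T \<Longrightarrow> v \<in> Hom C S T \<Longrightarrow> u \<bullet> i = v \<bullet> i \<Longrightarrow> u \<bullet> j = v \<bullet> j \<Longrightarrow> u = v"
  shows "is_coproduct2 C A B S i j"
  unfolding is_coproduct2_def
proof (intro conjI ballI)
  show "A \<in> Obj C" "B \<in> Obj C" "S \<in> Obj C" "i \<in> Hom C A S" "j \<in> Hom C B S"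
    using assms(1,2) HomD by auto
  fix T f g assume "T \<in> Obj C" "f \<in> Hom C A T" "g \<in> Hom C B T"
  then obtain u where u: "u \<in> Hom C S T \<and> u \<bullet> i = f \<and> u \<bullet> j = g"
    using assms(3) by blast
  show "\<exists>!u. u \<in> Hom C S T \<and> u \<bullet> i = f \<and> u \<bullet> j = g"
    using u by (rule ex1I) (rule assms(4)[of _ T], use u in auto)
qed

lemma coproduct2_sym: "is_coproduct2 C A B S i j \<Longrightarrow> is_coproduct2 C B A S j i"
  unfolding is_coproduct2_def by (simp add: conj_commute[of "_ \<bullet> j = _"])

lemma initial_unique: "is_initial C Z \<Longrightarrow> f \<in> Hom C Z A \<Longrightarrow> g \<in> Hom C Z A \<Longrightarrow> f = g"
  using HomD unfolding is_initial_def by blast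

lemma initialE:
  assumes "is_initial C Z" "A \<in> Obj C"
  obtains f where "f \<in> Hom C Z A"
  using assms unfolding is_initial_def by blast

text \<open>Besides giving the unit law, this degenerate diagram is the test case that extracts
  information from definitions quantifying over all coproducts: \<open>0 + 0 = 0\<close> for
  connected objects, \<open>X + 0 = X\<close> for extensivity.\<close>

lemma coproduct2_initial:
  assumes Z: "is_initial C Z" and z: "z \<in> Hom C Z A"
  shows "is_coproduct2 C A Z A (Idt C A) z"
proof (rule coproduct2I)
  show "Idt C A \<in> Hom C A A" "z \<in> Hom C Z A" using z HomD Idt_Hom by auto
  show "\<exists>u. u \<in> Hom C A T \<and> u \<bullet> Idt C A = f \<and> u \<bullet> z = g"
    if "f \<in> Hom C A T" "g \<in> Hom C Z T" for T f g
    using that Cmp_Idt[OF that(1)] initial_unique[OF Z Cmp_Hom[OF z that(1)] that(2)] by blast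
  show "u = v" if "u \<in> Hom C A T" "v \<in> Hom C A T" "u \<bullet> Idt C A = v \<bullet> Idt C A" for T u v
    using that Cmp_Idt by metis
qed

text \<open>The inverse copairs a map out of the initial \<open>A\<close> with the identity of
  \<open>B\<close>. This is how an initial summand is discarded.\<close>

lemma coproduct2_with_initial:
  assumes S: "is_coproduct2 C A B S i j" and A: "is_initial C A"
  obtains k where "k \<in> Hom C S B" "j \<bullet> k = Idt C S" "k \<bullet> j = Idt C B"
proof -
  note o = coproduct2_obj[OF S]
  obtain z where z: "z \<in> Hom C A B" using A o by (rule_tac initialE)
  obtain k where k: "k \<in> Hom C S B" "k \<bullet> i = z" "k \<bullet> j = Idt C B"
    using coproduct2_copair[OF S z Idt_Hom[OF o(2)]] by blast
  have jk: "j \<bullet> k \<in> Hom C S S" using k o Cmp_Hom by blast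
  have "j \<bullet> k = Idt C S"
  proof (rule coproduct2_eqI[OF S jk Idt_Hom[OF o(3)]])
    show "(j \<bullet> k) \<bullet> i = Idt C S \<bullet> i"
      using initial_unique[OF A] Cmp_Hom[OF o(4) jk] Cmp_Hom[OF o(4) Idt_Hom[OF o(3)]] by blast
    have "(j \<bullet> k) \<bullet> j = j \<bullet> Idt C B" using Cmp_assoc[OF o(5) k(1) o(5)] k(3) by simp
    then show "(j \<bullet> k) \<bullet> j = Idt C S \<bullet> j" using Cmp_Idt[OF o(5)] Idt_Cmp[OF o(5)] by simp
  qed
  then show thesis using that k by blast
qed

text \<open>Both bracketings are realised on the same apex \<open>Q\<close>, so associativity of
  classes needs no comparison of two objects. The map \<open>w\<close> copairs
  \<open>k \<bullet> j\<close> and \<open>l\<close>.\<close>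

lemma coproduct2_assoc:
  assumes P: "is_coproduct2 C A B P i j" and Q: "is_coproduct2 C P D Q k l"
    and R: "is_coproduct2 C B D R m n"
  obtains w where "is_coproduct2 C A R Q (k \<bullet> i) w"
proof -
  note p = coproduct2_obj[OF P] and q = coproduct2_obj[OF Q] and r = coproduct2_obj[OF R]
  have kj: "k \<bullet> j \<in> Hom C B Q" and ki: "k \<bullet> i \<in> Hom C A Q" using p q Cmp_Hom by blast+
  obtain w where w: "w \<in> Hom C R Q" "w \<bullet> m = k \<bullet> j" "w \<bullet> n = l"
    using coproduct2_copair[OF R kj q(5)] by blast
  have "is_coproduct2 C A R Q (k \<bullet> i) w"
  proof (rule coproduct2I[OF ki w(1)])
    fix T f g assume f: "f \<in> Hom C A T" and g: "g \<in> Hom C R T"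
    have gm: "g \<bullet> m \<in> Hom C B T" and gn: "g \<bullet> n \<in> Hom C D T" using g r Cmp_Hom by blast+
    obtain h where h: "h \<in> Hom C P T" "h \<bullet> i = f" "h \<bullet> j = g \<bullet> m"
      using coproduct2_copair[OF P f gm] by blast
    obtain u where u: "u \<in> Hom C Q T" "u \<bullet> k = h" "u \<bullet> l = g \<bullet> n"
      using coproduct2_copair[OF Q h(1) gn] by blast
    have "u \<bullet> k \<bullet> i = f" using Cmp_assoc[OF p(4) q(4) u(1)] u h by simp
    moreover have "u \<bullet> w = g"
    proof (rule coproduct2_eqI[OF R Cmp_Hom[OF w(1) u(1)] g])
      show "(u \<bullet> w) \<bullet> m = g \<bullet> m"
        using Cmp_assoc[OF r(4) w(1) u(1)] Cmp_assoc[OF p(5) q(4) u(1)] w u h by simp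
      show "(u \<bullet> w) \<bullet> n = g \<bullet> n" using Cmp_assoc[OF r(5) w(1) u(1)] w u by simp
    qed
    ultimately show "\<exists>u. u \<in> Hom C Q T \<and> u \<bullet> k \<bullet> i = f \<and> u \<bullet> w = g" using u by blast
  next
    fix T u v assume u: "u \<in> Hom C Q T" and v: "v \<in> Hom C Q T"
      and 1: "u \<bullet> k \<bullet> i = v \<bullet> k \<bullet> i" and 2: "u \<bullet> w = v \<bullet> w"
    show "u = v"
    proof (rule coproduct2_eqI[OF Q u v])
      show "u \<bullet> k = v \<bullet> k"
      proof (rule coproduct2_eqI[OF P Cmp_Hom[OF q(4) u] Cmp_Hom[OF q(4) v]])
        show "(u \<bullet> k) \<bullet> i = (v \<bullet> k) \<bullet> i"
          using Cmp_assoc[OF p(4) q(4) u] Cmp_assoc[OF p(4) q(4) v] 1 by simp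
        show "(u \<bullet> k) \<bullet> j = (v \<bullet> k) \<bullet> j"
          using Cmp_assoc[OF p(5) q(4) u] Cmp_assoc[OF p(5) q(4) v] w(2)
            Cmp_assoc[OF r(4) w(1) u] Cmp_assoc[OF r(4) w(1) v] 2 by simp
      qed
      show "u \<bullet> l = v \<bullet> l"
        using Cmp_assoc[OF r(5) w(1) u] Cmp_assoc[OF r(5) w(1) v] 2 w(3) by simp
    qed
  qed
  then show thesis by (rule that)
qed

text \<open>Restriction along the two coprojections is a bijection onto pairs of maps. The
  convention that \<open>card\<close> is 0 on infinite sets is compatible with products of
  sets.\<close>

lemma card_Hom_coproduct2:
  assumes S: "is_coproduct2 C A B S i j"
  shows "card (Hom C S T) = card (Hom C A T) * card (Hom C B T)"
proof -
  note o = coproduct2_obj[OF S]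
  have "bij_betw (\<lambda>u. (u \<bullet> i, u \<bullet> j)) (Hom C S T) (Hom C A T \<times> Hom C B T)"
  proof (rule bij_betwI')
    show "((u \<bullet> i, u \<bullet> j) = (v \<bullet> i, v \<bullet> j)) = (u = v)"
      if "u \<in> Hom C S T" "v \<in> Hom C S T" for u v
      using coproduct2_eqI[OF S that] by auto
    show "(u \<bullet> i, u \<bullet> j) \<in> Hom C A T \<times> Hom C B T" if "u \<in> Hom C S T" for u
      using that o Cmp_Hom by blast
    show "\<exists>u\<in>Hom C S T. y = (u \<bullet> i, u \<bullet> j)" if "y \<in> Hom C A T \<times> Hom C B T" for y
    proof -
      obtain f g where y: "y = (f, g)" "f \<in> Hom C A T" "g \<in> Hom C B T" using \<open>y \<in> _\<close> by blast
      obtain u where "u \<in> Hom C S T" "u \<bullet> i = f" "u \<bullet> j = g"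
        using coproduct2_copair[OF S y(2,3)] by blast
      then show ?thesis using y(1) by blast
    qed
  qed
  then show ?thesis by (simp add: bij_betw_same_card card_cartesian_product)
qed

lemma card_Hom_isomorphic_dom:
  assumes "isomorphic C A B"
  shows "card (Hom C A T) = card (Hom C B T)"
proof -
  obtain f g where f: "f \<in> Hom C A B" "g \<in> Hom C B A" "g \<bullet> f = Idt C A" "f \<bullet> g = Idt C B"
    using assms by (rule isomorphicE)
  have "bij_betw (\<lambda>u. u \<bullet> g) (Hom C A T) (Hom C B T)"
  proof (rule bij_betw_byWitness[where f' = "\<lambda>u. u \<bullet> f"])
    show "\<forall>u\<in>Hom C A T. (u \<bullet> g) \<bullet> f = u" using f by (simp add: cancel_right)
    show "\<forall>u\<in>Hom C B T. (u \<bullet> f) \<bullet> g = u" using f by (simp add: cancel_right)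
  qed (use f Cmp_Hom in blast)+
  then show ?thesis by (rule bij_betw_same_card)
qed

section \<open>Finite coproducts\<close>

lemma coproduct_obj:
  assumes "is_coproduct C K X S c"
  shows "S \<in> Obj C" "k \<in> K \<Longrightarrow> X k \<in> Obj C" "k \<in> K \<Longrightarrow> c k \<in> Hom C (X k) S"
  using assms by (auto simp: is_coproduct_def)

lemma coproduct_copair:
  assumes "is_coproduct C K X S c" "T \<in> Obj C" "\<And>k. k \<in> K \<Longrightarrow> f k \<in> Hom C (X k) T"
  obtains u where "u \<in> Hom C S T" "\<And>k. k \<in> K \<Longrightarrow> u \<bullet> c k = f k"
proof -
  have "\<forall>f. (\<forall>k\<in>K. f k \<in> Hom C (X k) T) \<longrightarrow>
      (\<exists>!w. w \<in> Hom C S T \<and> (\<forall>k\<in>K. w \<bullet> c k = f k))"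
    using assms(1,2) by (simp add: is_coproduct_def)
  then have "\<exists>!w. w \<in> Hom C S T \<and> (\<forall>k\<in>K. w \<bullet> c k = f k)"
    using assms(3) by simp
  then show thesis using that by blast
qed

lemma coproduct_eqI:
  assumes S: "is_coproduct C K X S c" and u: "u \<in> Hom C S T" and v: "v \<in> Hom C S T"
    and "\<And>k. k \<in> K \<Longrightarrow> u \<bullet> c k = v \<bullet> c k"
  shows "u = v"
proof -
  have "\<forall>k\<in>K. v \<bullet> c k \<in> Hom C (X k) T" using S v Cmp_Hom unfolding is_coproduct_def by blast
  moreover have "\<forall>f. (\<forall>k\<in>K. f k \<in> Hom C (X k) T) \<longrightarrow>
      (\<exists>!w. w \<in> Hom C S T \<and> (\<forall>k\<in>K. w \<bullet> c k = f k))"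
    using S HomD[OF u] by (simp add: is_coproduct_def)
  ultimately have "\<exists>!w. w \<in> Hom C S T \<and> (\<forall>k\<in>K. w \<bullet> c k = v \<bullet> c k)"
    by (auto dest: spec[of _ "\<lambda>k. v \<bullet> c k"])
  then show ?thesis using assms by blast
qed

lemma coproductI:
  assumes "S \<in> Obj C" "\<And>k. k \<in> K \<Longrightarrow> c k \<in> Hom C (X k) S"
    and "\<And>T f. T \<in> Obj C \<Longrightarrow> (\<And>k. k \<in> K \<Longrightarrow> f k \<in> Hom C (X k) T)
      \<Longrightarrow> \<exists>u. u \<in> Hom C S T \<and> (\<forall>k\<in>K. u \<bullet> c k = f k)"
    and "\<And>T u v. u \<in> Hom C S T \<Longrightarrow> v \<in> Hom C S T \<Longrightarrow> (\<And>k. k \<in> K \<Longrightarrow> u \<bullet> c k = v \<bullet> c k) \<Longrightarrow> u = v"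
  shows "is_coproduct C K X S c"
  unfolding is_coproduct_def
proof (intro conjI ballI allI impI)
  show "S \<in> Obj C" "\<And>k. k \<in> K \<Longrightarrow> X k \<in> Obj C" "\<And>k. k \<in> K \<Longrightarrow> c k \<in> Hom C (X k) S"
    using assms(1,2) HomD by auto
  fix T f assume T: "T \<in> Obj C" "\<forall>k\<in>K. f k \<in> Hom C (X k) T"
  then obtain u where u: "u \<in> Hom C S T \<and> (\<forall>k\<in>K. u \<bullet> c k = f k)"
    using assms(3)[of T f] by blast
  show "\<exists>!u. u \<in> Hom C S T \<and> (\<forall>k\<in>K. u \<bullet> c k = f k)"
    using u by (rule ex1I) (rule assms(4)[of _ T], use u in auto)
qed

lemma coproduct_Suc:
  fixes n :: nat
  assumes S: "is_coproduct C {..<n} X S c" and T: "is_coproduct2 C S B T i j"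
  shows "is_coproduct C {..<Suc n} (X(n := B)) T (\<lambda>k. if k < n then i \<bullet> c k else j)"
proof (rule coproductI)
  note t = coproduct2_obj[OF T] and s = coproduct_obj[OF S]
  show "T \<in> Obj C" by (rule t)
  show "(if k < n then i \<bullet> c k else j) \<in> Hom C ((X(n := B)) k) T" if "k \<in> {..<Suc n}" for k
    using that t s(3)[of k] Cmp_Hom by (auto simp: less_Suc_eq)
  fix W
  show "\<exists>u. u \<in> Hom C T W \<and> (\<forall>k\<in>{..<Suc n}. u \<bullet> (if k < n then i \<bullet> c k else j) = f k)"
    if W: "W \<in> Obj C" and f: "\<And>k. k \<in> {..<Suc n} \<Longrightarrow> f k \<in> Hom C ((X(n := B)) k) W" for f
  proof -
    have fk: "f k \<in> Hom C (X k) W" if "k \<in> {..<n}" for k using f[of k] that by simp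
    have fn: "f n \<in> Hom C B W" using f[of n] by simp
    obtain g where g: "g \<in> Hom C S W" "\<And>k. k \<in> {..<n} \<Longrightarrow> g \<bullet> c k = f k"
      using coproduct_copair[OF S W fk] by blast
    obtain u where u: "u \<in> Hom C T W" "u \<bullet> i = g" "u \<bullet> j = f n"
      using coproduct2_copair[OF T g(1) fn] by blast
    have "u \<bullet> i \<bullet> c k = f k" if "k \<in> {..<n}" for k
      using Cmp_assoc[OF s(3)[OF that] t(4) u(1)] u(2) g(2)[OF that] by simp
    then show ?thesis using u by (auto simp: less_Suc_eq)
  qed
  show "u = v" if u: "u \<in> Hom C T W" and v: "v \<in> Hom C T W"
    and e: "\<And>k. k \<in> {..<Suc n} \<Longrightarrow> u \<bullet> (if k < n then i \<bullet> c k else j)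
      = v \<bullet> (if k < n then i \<bullet> c k else j)" for u v
  proof (rule coproduct2_eqI[OF T u v])
    show "u \<bullet> j = v \<bullet> j" using e[of n] by simp
    show "u \<bullet> i = v \<bullet> i"
    proof (rule coproduct_eqI[OF S Cmp_Hom[OF t(4) u] Cmp_Hom[OF t(4) v]])
      show "(u \<bullet> i) \<bullet> c k = (v \<bullet> i) \<bullet> c k" if k: "k \<in> {..<n}" for k
        using e[of k] k Cmp_assoc[OF s(3)[OF k] t(4)] u v by simp
    qed
  qed
qed

text \<open>Any coproduct of the first \<open>n\<close> summands may be prescribed, so an induction
  on \<open>n\<close> can choose it freely and pass to a binary coproduct. Compatibility with the
  coprojections carries the induction hypothesis back to \<open>T\<close>.\<close>

lemma coproduct_Suc_split:
  fixes n :: nat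
  assumes T: "is_coproduct C {..<Suc n} X T d" and S: "is_coproduct C {..<n} X S c"
  obtains i where "is_coproduct2 C S (X n) T i (d n)" "\<And>k. k < n \<Longrightarrow> i \<bullet> c k = d k"
proof -
  note t = coproduct_obj[OF T] and s = coproduct_obj[OF S]
  have dk: "d k \<in> Hom C (X k) T" if "k \<in> {..<n}" for k using t(3)[of k] that by simp
  obtain i where i: "i \<in> Hom C S T" "\<And>k. k \<in> {..<n} \<Longrightarrow> i \<bullet> c k = d k"
    using coproduct_copair[OF S t(1) dk] by blast
  have dn: "d n \<in> Hom C (X n) T" using t(3) by simp
  have uik: "(u \<bullet> i) \<bullet> c k = u \<bullet> d k" if "u \<in> Hom C T W" "k \<in> {..<n}" for u W k
    using Cmp_assoc[OF s(3)[OF that(2)] i(1) that(1)] i(2)[OF that(2)] by simp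
  have "is_coproduct2 C S (X n) T i (d n)"
  proof (rule coproduct2I[OF i(1) dn])
    fix W f g assume f: "f \<in> Hom C S W" and g: "g \<in> Hom C (X n) W"
    have h: "(if k < n then f \<bullet> c k else g) \<in> Hom C (X k) W" if "k \<in> {..<Suc n}" for k
      using that f g s(3)[of k] Cmp_Hom by (auto simp: less_Suc_eq)
    obtain u where u: "u \<in> Hom C T W"
      "\<And>k. k \<in> {..<Suc n} \<Longrightarrow> u \<bullet> d k = (if k < n then f \<bullet> c k else g)"
      using coproduct_copair[OF T _ h] HomD[OF f] by blast
    have "u \<bullet> i = f"
    proof (rule coproduct_eqI[OF S Cmp_Hom[OF i(1) u(1)] f])
      show "(u \<bullet> i) \<bullet> c k = f \<bullet> c k" if "k \<in> {..<n}" for k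
        using uik[OF u(1) that] u(2)[of k] that by simp
    qed
    then show "\<exists>u. u \<in> Hom C T W \<and> u \<bullet> i = f \<and> u \<bullet> d n = g"
      using u(1) u(2)[of n] by auto
  next
    fix W u v assume u: "u \<in> Hom C T W" and v: "v \<in> Hom C T W"
      and e: "u \<bullet> i = v \<bullet> i" "u \<bullet> d n = v \<bullet> d n"
    show "u = v"
    proof (rule coproduct_eqI[OF T u v])
      show "u \<bullet> d k = v \<bullet> d k" if "k \<in> {..<Suc n}" for k
        using that e uik[OF u, of k] uik[OF v, of k] by (cases "k = n") auto
    qed
  qed
  then show thesis using that i(2) by blast
qed

section \<open>Connected objects\<close>

text \<open>Surjectivity becomes factorization through one of the coprojections, and injectivity
  falls into three properties that are later used separately. Composites always land in
  \<open>Hom C D S\<close>, so only one inclusion of surjectivity carries information.\<close>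

lemma connected_object_iff:
  "connected_object C D \<longleftrightarrow> D \<in> Obj C \<and>
    (\<forall>A B S i j. is_coproduct2 C A B S i j \<longrightarrow>
      (\<forall>f\<in>Hom C D S. (\<exists>g\<in>Hom C D A. f = i \<bullet> g) \<or> (\<exists>g\<in>Hom C D B. f = j \<bullet> g)) \<and>
      inj_on (\<lambda>g. i \<bullet> g) (Hom C D A) \<and> inj_on (\<lambda>g. j \<bullet> g) (Hom C D B) \<and>
      (\<forall>g\<in>Hom C D A. \<forall>h\<in>Hom C D B. i \<bullet> g \<noteq> j \<bullet> h))"
proof -
  have "bij_betw (case_sum (\<lambda>f. i \<bullet> f) (\<lambda>g. j \<bullet> g)) (Hom C D A <+> Hom C D B) (Hom C D S)
    \<longleftrightarrow> (\<forall>f\<in>Hom C D S. (\<exists>g\<in>Hom C D A. f = i \<bullet> g) \<or> (\<exists>g\<in>Hom C D B. f = j \<bullet> g)) \<and>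
      inj_on (\<lambda>g. i \<bullet> g) (Hom C D A) \<and> inj_on (\<lambda>g. j \<bullet> g) (Hom C D B) \<and>
      (\<forall>g\<in>Hom C D A. \<forall>h\<in>Hom C D B. i \<bullet> g \<noteq> j \<bullet> h)"
    if S: "is_coproduct2 C A B S i j" for A B S i j
  proof -
    note o = coproduct2_obj[OF S]
    have sub: "(\<lambda>f. i \<bullet> f) ` Hom C D A \<union> (\<lambda>g. j \<bullet> g) ` Hom C D B \<subseteq> Hom C D S"
      by (intro Un_least image_subsetI) (rule Cmp_Hom[OF _ o(4)] Cmp_Hom[OF _ o(5)]; assumption)+
    have inj: "inj_on (case_sum (\<lambda>f. i \<bullet> f) (\<lambda>g. j \<bullet> g)) (Hom C D A <+> Hom C D B) \<longleftrightarrow>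
      inj_on (\<lambda>g. i \<bullet> g) (Hom C D A) \<and> inj_on (\<lambda>g. j \<bullet> g) (Hom C D B) \<and>
      (\<forall>g\<in>Hom C D A. \<forall>h\<in>Hom C D B. i \<bullet> g \<noteq> j \<bullet> h)"
      by (rule inj_on_case_sum_iff)
    have img: "case_sum (\<lambda>f. i \<bullet> f) (\<lambda>g. j \<bullet> g) ` (Hom C D A <+> Hom C D B)
      = (\<lambda>f. i \<bullet> f) ` Hom C D A \<union> (\<lambda>g. j \<bullet> g) ` Hom C D B"
      by (simp add: Plus_def image_Un image_image)
    have surj: "case_sum (\<lambda>f. i \<bullet> f) (\<lambda>g. j \<bullet> g) ` (Hom C D A <+> Hom C D B) = Hom C D S
      \<longleftrightarrow> (\<forall>f\<in>Hom C D S. (\<exists>g\<in>Hom C D A. f = i \<bullet> g) \<or> (\<exists>g\<in>Hom C D B. f = j \<bullet> g))"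
      using sub unfolding img by blast
    show ?thesis unfolding bij_betw_def inj surj by (simp only: conj_ac)
  qed
  then show ?thesis unfolding connected_object_def by (simp only: cong: imp_cong)
qed

lemma connected_objD:
  assumes "connected_object C D" "is_coproduct2 C A B S i j"
  shows "f \<in> Hom C D S \<Longrightarrow> (\<exists>g\<in>Hom C D A. f = i \<bullet> g) \<or> (\<exists>g\<in>Hom C D B. f = j \<bullet> g)"
    and "g \<in> Hom C D A \<Longrightarrow> g' \<in> Hom C D A \<Longrightarrow> i \<bullet> g = i \<bullet> g' \<Longrightarrow> g = g'"
    and "h \<in> Hom C D B \<Longrightarrow> h' \<in> Hom C D B \<Longrightarrow> j \<bullet> h = j \<bullet> h' \<Longrightarrow> h = h'"
    and "g \<in> Hom C D A \<Longrightarrow> h \<in> Hom C D B \<Longrightarrow> i \<bullet> g \<noteq> j \<bullet> h"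
proof -
  have "(\<forall>f\<in>Hom C D S. (\<exists>g\<in>Hom C D A. f = i \<bullet> g) \<or> (\<exists>g\<in>Hom C D B. f = j \<bullet> g)) \<and>
      inj_on (\<lambda>g. i \<bullet> g) (Hom C D A) \<and> inj_on (\<lambda>g. j \<bullet> g) (Hom C D B) \<and>
      (\<forall>g\<in>Hom C D A. \<forall>h\<in>Hom C D B. i \<bullet> g \<noteq> j \<bullet> h)"
    using assms(1)[unfolded connected_object_iff] assms(2) by simp
  then show "f \<in> Hom C D S \<Longrightarrow> (\<exists>g\<in>Hom C D A. f = i \<bullet> g) \<or> (\<exists>g\<in>Hom C D B. f = j \<bullet> g)"
    and "g \<in> Hom C D A \<Longrightarrow> g' \<in> Hom C D A \<Longrightarrow> i \<bullet> g = i \<bullet> g' \<Longrightarrow> g = g'"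
    and "h \<in> Hom C D B \<Longrightarrow> h' \<in> Hom C D B \<Longrightarrow> j \<bullet> h = j \<bullet> h' \<Longrightarrow> h = h'"
    and "g \<in> Hom C D A \<Longrightarrow> h \<in> Hom C D B \<Longrightarrow> i \<bullet> g \<noteq> j \<bullet> h"
    by (simp_all add: inj_on_def)
qed

text \<open>Connectedness speaks only of maps out of the object. Precomposition with
  \<open>a\<close> identifies maps out of \<open>E\<close> with maps out of \<open>D\<close> and
  commutes with composing a coprojection afterwards.\<close>

lemma connected_isomorphic:
  assumes D: "connected_object C D" and DE: "isomorphic C D E"
  shows "connected_object C E"
  unfolding connected_object_iff inj_on_def
proof (intro conjI allI impI ballI)
  obtain a b where a: "a \<in> Hom C D E" "b \<in> Hom C E D" "b \<bullet> a = Idt C D" "a \<bullet> b = Idt C E"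
    using DE by (rule isomorphicE)
  show "E \<in> Obj C" using a HomD by blast
  fix A B S i j assume S: "is_coproduct2 C A B S i j"
  note o = coproduct2_obj[OF S]
  have restore: "(f \<bullet> a) \<bullet> b = f" if "f \<in> Hom C E T" for f T
    using cancel_right[OF that a(2,1,4)] .
  have cancel: "f = g" if "f \<in> Hom C E T" "g \<in> Hom C E T" "f \<bullet> a = g \<bullet> a" for f g T
    using that restore by metis
  have pull: "k \<bullet> g \<bullet> a = l \<bullet> h \<bullet> a"
    if "k \<in> Hom C A' S" "g \<in> Hom C E A'" "l \<in> Hom C B' S" "h \<in> Hom C E B'" "k \<bullet> g = l \<bullet> h"
    for k g A' l h B'
    using Cmp_assoc[OF a(1) that(2,1)] Cmp_assoc[OF a(1) that(4,3)] that(5) by simp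
  show "(\<exists>g\<in>Hom C E A. f = i \<bullet> g) \<or> (\<exists>g\<in>Hom C E B. f = j \<bullet> g)" if f: "f \<in> Hom C E S" for f
    using connected_objD(1)[OF D S Cmp_Hom[OF a(1) f]]
  proof (elim disjE bexE)
    fix g assume g: "g \<in> Hom C D A" "f \<bullet> a = i \<bullet> g"
    have "f = i \<bullet> g \<bullet> b" using restore[OF f] Cmp_assoc[OF a(2) g(1) o(4)] g(2) by simp
    then show ?thesis using Cmp_Hom[OF a(2) g(1)] by blast
  next
    fix g assume g: "g \<in> Hom C D B" "f \<bullet> a = j \<bullet> g"
    have "f = j \<bullet> g \<bullet> b" using restore[OF f] Cmp_assoc[OF a(2) g(1) o(5)] g(2) by simp
    then show ?thesis using Cmp_Hom[OF a(2) g(1)] by blast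
  qed
  show "g = h" if "g \<in> Hom C E A" "h \<in> Hom C E A" "i \<bullet> g = i \<bullet> h" for g h
    using connected_objD(2)[OF D S] pull[OF o(4) that(1) o(4) that(2,3)] cancel[OF that(1,2)]
      Cmp_Hom[OF a(1) that(1)] Cmp_Hom[OF a(1) that(2)] by blast
  show "g = h" if "g \<in> Hom C E B" "h \<in> Hom C E B" "j \<bullet> g = j \<bullet> h" for g h
    using connected_objD(3)[OF D S] pull[OF o(5) that(1) o(5) that(2,3)] cancel[OF that(1,2)]
      Cmp_Hom[OF a(1) that(1)] Cmp_Hom[OF a(1) that(2)] by blast
  show "i \<bullet> g \<noteq> j \<bullet> h" if "g \<in> Hom C E A" "h \<in> Hom C E B" for g h
    using connected_objD(4)[OF D S] pull[OF o(4) that(1) o(5) that(2)]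
      Cmp_Hom[OF a(1) that(1)] Cmp_Hom[OF a(1) that(2)] by blast
qed

text \<open>In \<open>0 + 0 = 0\<close> both coprojections are the identity, so a map from
  \<open>D\<close> to \<open>0\<close> would factor through both summands, against
  disjointness.\<close>

lemma connected_Hom_initial:
  assumes D: "connected_object C D" and Z: "is_initial C Z"
  shows "Hom C D Z = {}"
proof -
  have "Z \<in> Obj C" using Z by (simp add: is_initial_def)
  then have "is_coproduct2 C Z Z Z (Idt C Z) (Idt C Z)"
    by (intro coproduct2_initial[OF Z] Idt_Hom)
  then show ?thesis using connected_objD(4)[OF D] by blast
qed

text \<open>Finiteness matters here: \<open>card\<close> is 0 on infinite sets, which is not
  compatible with disjoint unions.\<close>

lemma card_Hom_connected:
  assumes "connected_object C D" "is_coproduct2 C A B S i j" "locally_finite C"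
  shows "card (Hom C D S) = card (Hom C D A) + card (Hom C D B)"
proof -
  have "card (Hom C D S) = card (Hom C D A <+> Hom C D B)"
    using assms(1,2) bij_betw_same_card unfolding connected_object_def by metis
  also have "\<dots> = card (Hom C D A) + card (Hom C D B)"
    using assms coproduct2_obj[OF assms(2)]
    by (intro card_Plus) (auto simp: locally_finite_def connected_object_def)
  finally show ?thesis .
qed

end

section \<open>Categories with finite coproducts\<close>

locale category_with_coproducts = category +
  assumes finite_coproducts: "has_finite_coproducts C"
begin

lemma initial_exists: obtains Z where "is_initial C Z"
proof -
  obtain Z and c :: "nat \<Rightarrow> 'b" where "is_coproduct C {..<0::nat} (\<lambda>_. undefined) Z c"
    using finite_coproducts[unfolded has_finite_coproducts_def, rule_format, of 0 "\<lambda>_. undefined"] by auto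
  then show thesis using that by (simp add: is_coproduct_empty)
qed

lemma coproduct2_exists:
  assumes "A \<in> Obj C" "B \<in> Obj C"
  obtains S i j where "is_coproduct2 C A B S i j"
proof -
  define X where "X k = (if k = 0 then A else B)" for k :: nat
  have "\<forall>k<2. X k \<in> Obj C" using assms by (simp add: X_def)
  then obtain S c where S: "is_coproduct C {..<2::nat} X S c"
    using finite_coproducts unfolding has_finite_coproducts_def by blast
  note s = coproduct_obj[OF S]
  have c: "c 0 \<in> Hom C A S" "c 1 \<in> Hom C B S" using s(3)[of 0] s(3)[of 1] by (simp_all add: X_def)
  have two: "k = 0 \<or> k = 1" if "k \<in> {..<2}" for k :: nat using that by auto
  have "is_coproduct2 C A B S (c 0) (c 1)"
  proof (rule coproduct2I[OF c])
    fix T f g assume f: "f \<in> Hom C A T" and g: "g \<in> Hom C B T"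
    have h: "(if k = 0 then f else g) \<in> Hom C (X k) T" if "k \<in> {..<2}" for k
      using two[OF that] f g by (auto simp: X_def)
    obtain u where "u \<in> Hom C S T" "\<And>k. k \<in> {..<2} \<Longrightarrow> u \<bullet> c k = (if k = 0 then f else g)"
      using coproduct_copair[OF S _ h] HomD[OF f] by blast
    from this(1) this(2)[of 0] this(2)[of 1]
    show "\<exists>u. u \<in> Hom C S T \<and> u \<bullet> c 0 = f \<and> u \<bullet> c 1 = g" by auto
  next
    fix T u v assume u: "u \<in> Hom C S T" and v: "v \<in> Hom C S T"
      and e: "u \<bullet> c 0 = v \<bullet> c 0" "u \<bullet> c 1 = v \<bullet> c 1"
    show "u = v"
    proof (rule coproduct_eqI[OF S u v])
      show "u \<bullet> c k = v \<bullet> c k" if "k \<in> {..<2}" for k using two[OF that] e by auto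
    qed
  qed
  then show thesis by (rule that)
qed

section \<open>The commutative monoid of isomorphism classes\<close>

lemma dec_comm_monoid: "comm_monoid (dec_monoid C)"
proof (rule comm_monoidI)
  show "\<one>\<^bsub>dec_monoid C\<^esub> \<in> carrier (dec_monoid C)"
  proof -
    obtain Z where Z: "is_initial C Z" by (rule initial_exists)
    then show ?thesis
      unfolding dec_monoid_zero[OF Z] by (intro iso_class_in_dec) (simp add: is_initial_def)
  qed
next
  fix x y assume "x \<in> carrier (dec_monoid C)" "y \<in> carrier (dec_monoid C)"
  then obtain A B where A: "A \<in> Obj C" "x = iso_class C A" and B: "B \<in> Obj C" "y = iso_class C B"
    by (metis dec_carrierE)
  obtain S i j where S: "is_coproduct2 C A B S i j" using coproduct2_exists[OF A(1) B(1)] .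
  have xy: "x \<otimes>\<^bsub>dec_monoid C\<^esub> y = iso_class C S" using dec_monoid_add[OF S] A B by simp
  then show "x \<otimes>\<^bsub>dec_monoid C\<^esub> y \<in> carrier (dec_monoid C)"
    using coproduct2_obj(3)[OF S] iso_class_in_dec by simp
  show "x \<otimes>\<^bsub>dec_monoid C\<^esub> y = y \<otimes>\<^bsub>dec_monoid C\<^esub> x"
    using xy dec_monoid_add[OF coproduct2_sym[OF S]] A B by simp
next
  fix x y z
  assume "x \<in> carrier (dec_monoid C)" "y \<in> carrier (dec_monoid C)" "z \<in> carrier (dec_monoid C)"
  then obtain A B D where A: "A \<in> Obj C" "x = iso_class C A" and B: "B \<in> Obj C" "y = iso_class C B"
    and D: "D \<in> Obj C" "z = iso_class C D"
    by (metis dec_carrierE)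
  obtain P i j where P: "is_coproduct2 C A B P i j" using coproduct2_exists[OF A(1) B(1)] .
  obtain R m n where R: "is_coproduct2 C B D R m n" using coproduct2_exists[OF B(1) D(1)] .
  obtain Q k l where Q: "is_coproduct2 C P D Q k l"
    using coproduct2_exists[OF coproduct2_obj(3)[OF P] D(1)] .
  obtain w where "is_coproduct2 C A R Q (k \<bullet> i) w" using coproduct2_assoc[OF P Q R] .
  from dec_monoid_add[OF this] dec_monoid_add[OF P] dec_monoid_add[OF Q] dec_monoid_add[OF R]
  show "x \<otimes>\<^bsub>dec_monoid C\<^esub> y \<otimes>\<^bsub>dec_monoid C\<^esub> z = x \<otimes>\<^bsub>dec_monoid C\<^esub> (y \<otimes>\<^bsub>dec_monoid C\<^esub> z)"
    using A B D by simp
next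
  fix x assume "x \<in> carrier (dec_monoid C)"
  then obtain A where A: "A \<in> Obj C" "x = iso_class C A" by (rule dec_carrierE)
  obtain Z where Z: "is_initial C Z" by (rule initial_exists)
  obtain z where "z \<in> Hom C Z A" using initialE[OF Z A(1)] .
  from dec_monoid_add[OF coproduct2_sym[OF coproduct2_initial[OF Z this]]]
  show "\<one>\<^bsub>dec_monoid C\<^esub> \<otimes>\<^bsub>dec_monoid C\<^esub> x = x"
    by (simp add: dec_monoid_zero[OF Z] A)
qed

sublocale Dec: comm_monoid "dec_monoid C"
  by (rule dec_comm_monoid)

section \<open>Finite coproducts as sums of lists of classes\<close>

lemma dec_mult_memE:
  assumes "S \<in> x \<otimes>\<^bsub>dec_monoid C\<^esub> y"
  obtains A B i j where "A \<in> x" "B \<in> y" "is_coproduct2 C A B S i j"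
  using assms by (auto simp: dec_monoid_def)

text \<open>In this \<open>foldr\<close> form, closure and invariance under permutation are the
  \<open>multlist\<close> facts about lists of factors, and concatenation models the sum.\<close>

abbreviation dec_sum :: "'a set list \<Rightarrow> 'a set"
  where "dec_sum es \<equiv> foldr (\<otimes>\<^bsub>dec_monoid C\<^esub>) es \<one>\<^bsub>dec_monoid C\<^esub>"

text \<open>The list is reversed because the last summand is the one split off and becomes the head.
  Any coproduct of the remaining summands will do, since only classes are compared.\<close>

lemma coproduct_dec_sum:
  fixes n :: nat
  assumes "is_coproduct C {..<n} X S c"
  shows "iso_class C S = dec_sum (map (\<lambda>k. iso_class C (X k)) (rev [0..<n]))"
  using assms
proof (induction n arbitrary: S c)
  case 0
  then have "is_initial C S" by (simp add: is_coproduct_empty)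
  then show ?case by (simp add: dec_monoid_zero)
next
  case (Suc n)
  have "\<forall>k<n. X k \<in> Obj C" using coproduct_obj(2)[OF Suc.prems] by simp
  then obtain T d where T: "is_coproduct C {..<n} X T d"
    using finite_coproducts unfolding has_finite_coproducts_def by blast
  obtain i where i: "is_coproduct2 C T (X n) S i (c n)"
    using coproduct_Suc_split[OF Suc.prems T] by blast
  show ?case using dec_monoid_add[OF coproduct2_sym[OF i]] Suc.IH[OF T] by simp
qed

text \<open>Sums are sets of objects, so a member \<open>S\<close> is itself the apex of a coproduct
  and no transport along an isomorphism is required. The head of the list becomes the summand of
  highest index, whence \<open>rev\<close>.\<close>

lemma dec_sum_coproduct:
  assumes "set es \<subseteq> carrier (dec_monoid C)" "S \<in> dec_sum es"
  obtains X c where "is_coproduct C {..<length es} X S c"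
    "map (\<lambda>k. iso_class C (X k)) [0..<length es] = rev es"
proof -
  have "\<exists>X c. is_coproduct C {..<length es} X S c
      \<and> map (\<lambda>k. iso_class C (X k)) [0..<length es] = rev es"
    using assms
  proof (induction es arbitrary: S)
    case Nil
    then show ?case by (simp add: dec_monoid_def is_coproduct_empty)
  next
    case (Cons e es)
    obtain A B i j where A: "A \<in> e" and B: "B \<in> dec_sum es" and S: "is_coproduct2 C A B S i j"
      using Cons.prems(2) by (auto elim: dec_mult_memE)
    obtain X c where X: "is_coproduct C {..<length es} X B c"
      "map (\<lambda>k. iso_class C (X k)) [0..<length es] = rev es"
      using Cons.IH[OF _ B] Cons.prems(1) by auto
    have "iso_class C A = e" using dec_carrier_memE(2)[OF _ A] Cons.prems(1) by simp
    then have "map (\<lambda>k. iso_class C ((X(length es := A)) k)) [0..<length (e # es)] = rev (e # es)"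
      by (simp flip: X(2))
    then show ?case using coproduct_Suc[OF X(1) coproduct2_sym[OF S]] by auto
  qed
  then show thesis using that by blast
qed

text \<open>The binary condition is iterated by splitting off the last summand. The induction starts
  at the initial object, into which a connected object has no map.\<close>

lemma connected_factor:
  fixes n :: nat
  assumes D: "connected_object C D" and "is_coproduct C {..<n} X S c" "f \<in> Hom C D S"
  obtains k g where "k < n" "g \<in> Hom C D (X k)" "f = c k \<bullet> g"
proof -
  have "\<exists>k g. k < n \<and> g \<in> Hom C D (X k) \<and> f = c k \<bullet> g"
    using assms(2,3)
  proof (induction n arbitrary: S c f)
    case 0
    then show ?case using connected_Hom_initial[OF D, of S] by (auto simp: is_coproduct_empty)
  next
    case (Suc n)
    have "\<forall>k<n. X k \<in> Obj C" using coproduct_obj(2)[OF Suc.prems(1)] by simp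
    then obtain T d where T: "is_coproduct C {..<n} X T d"
      using finite_coproducts unfolding has_finite_coproducts_def by blast
    obtain i where i: "is_coproduct2 C T (X n) S i (c n)" "\<And>k. k < n \<Longrightarrow> i \<bullet> d k = c k"
      using coproduct_Suc_split[OF Suc.prems(1) T] by blast
    from connected_objD(1)[OF D i(1) Suc.prems(2)] show ?case
    proof (elim disjE bexE)
      fix g assume g: "g \<in> Hom C D T" "f = i \<bullet> g"
      obtain k h where h: "k < n" "h \<in> Hom C D (X k)" "g = d k \<bullet> h"
        using Suc.IH[OF T g(1)] by blast
      have "d k \<in> Hom C (X k) T" using coproduct_obj(3)[OF T] h(1) by simp
      then have "f = c k \<bullet> h"
        using g(2) h i(2)[OF h(1)] Cmp_assoc[OF h(2) _ coproduct2_obj(4)[OF i(1)]] by metis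
      then show ?thesis using h less_SucI by blast
    next
      fix g assume "g \<in> Hom C D (X n)" "f = c n \<bullet> g"
      then show ?thesis by blast
    qed
  qed
  then show thesis using that by blast
qed

text \<open>Of the four positions of \<open>k\<close> and \<open>l\<close> relative to the last
  index, the mixed ones contradict disjointness; the others use that both coprojections of a binary
  coproduct are injective on maps out of \<open>D\<close>.\<close>

lemma connected_factor_unique:
  fixes n :: nat
  assumes D: "connected_object C D" and "is_coproduct C {..<n} X S c"
    and "k < n" "l < n" "g \<in> Hom C D (X k)" "h \<in> Hom C D (X l)" "c k \<bullet> g = c l \<bullet> h"
  shows "k = l \<and> g = h"
  using assms(2-)
proof (induction n arbitrary: S c k l g h)
  case 0
  then show ?case by simp
next
  case (Suc n)
  have "\<forall>k<n. X k \<in> Obj C" using coproduct_obj(2)[OF Suc.prems(1)] by simp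
  then obtain T d where T: "is_coproduct C {..<n} X T d"
    using finite_coproducts unfolding has_finite_coproducts_def by blast
  obtain i where i: "is_coproduct2 C T (X n) S i (c n)" "\<And>k. k < n \<Longrightarrow> i \<bullet> d k = c k"
    using coproduct_Suc_split[OF Suc.prems(1) T] by blast
  have dk: "d k \<bullet> g \<in> Hom C D T" "c k \<bullet> g = i \<bullet> d k \<bullet> g" if "k < n" "g \<in> Hom C D (X k)" for k g
  proof -
    have "d k \<in> Hom C (X k) T" using coproduct_obj(3)[OF T] that(1) by simp
    then show "d k \<bullet> g \<in> Hom C D T" "c k \<bullet> g = i \<bullet> d k \<bullet> g"
      using Cmp_assoc[OF that(2) _ coproduct2_obj(4)[OF i(1)], of "d k"] i(2)[OF that(1)]
        Cmp_Hom[OF that(2)]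
      by simp_all
  qed
  note p = Suc.prems
  consider "k < n" "l < n" | "k < n" "l = n" | "k = n" "l < n" | "k = n" "l = n"
    using p(2,3) by linarith
  then show ?case
  proof cases
    case 1
    have "d k \<bullet> g = d l \<bullet> h"
      using connected_objD(2)[OF D i(1)] dk[OF 1(1) p(4)] dk[OF 1(2) p(5)] p(6) by metis
    then show ?thesis using Suc.IH[OF T 1 p(4,5)] by blast
  next
    case 2
    have "h \<in> Hom C D (X n)" using 2(2) p(5) by simp
    from connected_objD(4)[OF D i(1) dk(1)[OF 2(1) p(4)] this] show ?thesis
      using dk(2)[OF 2(1) p(4)] p(6) 2 by simp
  next
    case 3
    have "g \<in> Hom C D (X n)" using 3(1) p(4) by simp
    from connected_objD(4)[OF D i(1) dk(1)[OF 3(2) p(5)] this] show ?thesis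
      using dk(2)[OF 3(2) p(5)] p(6) 3 by simp
  next
    case 4
    then show ?thesis using connected_objD(3)[OF D i(1), of g h] p(4-6) by simp
  qed
qed

text \<open>A Krull--Schmidt theorem. A coprojection \<open>c k\<close> of the first decomposition factors through
  a unique \<open>d l\<close>, and the factor is an isomorphism because it has an inverse obtained in the
  same way.\<close>

lemma connected_decomposition_unique:
  fixes n m :: nat
  assumes X: "is_coproduct C {..<n} X S c" "\<And>k. k < n \<Longrightarrow> connected_object C (X k)"
    and Y: "is_coproduct C {..<m} Y S d" "\<And>k. k < m \<Longrightarrow> connected_object C (Y k)"
  shows "mset (map (\<lambda>k. iso_class C (X k)) [0..<n]) = mset (map (\<lambda>k. iso_class C (Y k)) [0..<m])"
proof -
  \<comment> \<open>Stated for arbitrary families because it is applied in both directions; the same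
    holds for \<open>inverse\<close> below.\<close>
  have ex: "\<exists>s a. \<forall>k<n. s k < m \<and> a k \<in> Hom C (X k) (Y (s k)) \<and> c k = d (s k) \<bullet> a k"
    if X: "is_coproduct C {..<n} X S c" "\<And>k. k < n \<Longrightarrow> connected_object C (X k)"
    and Y: "is_coproduct C {..<m} Y S d"
    for X Y c d and n m :: nat
  proof -
    have "\<forall>k. \<exists>l a. k < n \<longrightarrow> l < m \<and> a \<in> Hom C (X k) (Y l) \<and> c k = d l \<bullet> a"
    proof
      fix k
      show "\<exists>l a. k < n \<longrightarrow> l < m \<and> a \<in> Hom C (X k) (Y l) \<and> c k = d l \<bullet> a"
      proof (cases "k < n")
        case True
        then have "c k \<in> Hom C (X k) S" using coproduct_obj(3)[OF X(1)] by simp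
        then obtain l a where "l < m" "a \<in> Hom C (X k) (Y l)" "c k = d l \<bullet> a"
          using connected_factor[OF X(2)[OF True] Y] by blast
        then show ?thesis by blast
      qed simp
    qed
    then show ?thesis by metis
  qed
  obtain s a where a': "\<forall>k<n. s k < m \<and> a k \<in> Hom C (X k) (Y (s k)) \<and> c k = d (s k) \<bullet> a k"
    using ex[OF X Y(1)] by blast
  then have a: "\<And>k. k < n \<Longrightarrow> s k < m" "\<And>k. k < n \<Longrightarrow> a k \<in> Hom C (X k) (Y (s k))" by auto
  obtain t b where b': "\<forall>k<m. t k < n \<and> b k \<in> Hom C (Y k) (X (t k)) \<and> d k = c (t k) \<bullet> b k"
    using ex[OF Y X(1)] by blast
  then have b: "\<And>k. k < m \<Longrightarrow> t k < n" "\<And>k. k < m \<Longrightarrow> b k \<in> Hom C (Y k) (X (t k))" by auto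
  have inverse: "t (s k) = k" "b (s k) \<bullet> a k = Idt C (X k)"
    if X: "is_coproduct C {..<n} X S c" "\<forall>k<n. connected_object C (X k)"
    and a: "\<forall>k<n. s k < m \<and> a k \<in> Hom C (X k) (Y (s k)) \<and> c k = d (s k) \<bullet> a k"
    and b: "\<forall>k<m. t k < n \<and> b k \<in> Hom C (Y k) (X (t k)) \<and> d k = c (t k) \<bullet> b k"
    and k: "k < n"
    for X Y c d s a t b k and n m :: nat
  proof -
    have sk: "s k < m" and tsk: "t (s k) < n" and conn: "connected_object C (X k)"
      and ak: "a k \<in> Hom C (X k) (Y (s k))" "c k = d (s k) \<bullet> a k"
      and bsk: "b (s k) \<in> Hom C (Y (s k)) (X (t (s k)))" "d (s k) = c (t (s k)) \<bullet> b (s k)"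
      using X(2) a b k by auto
    have ct: "c (t (s k)) \<in> Hom C (X (t (s k))) S" and ck: "c k \<in> Hom C (X k) S"
      using coproduct_obj(3)[OF X(1)] tsk k by auto
    \<comment> \<open>Going to the other decomposition and back factors \<open>c k\<close> through
      \<open>c (t (s k))\<close>, while the identity factors it through itself. Uniqueness of the
      factorization yields the index and the inverse at once.\<close>
    have "c (t (s k)) \<bullet> b (s k) \<bullet> a k = c k"
      using Cmp_assoc[OF ak(1) bsk(1) ct] ak(2) bsk(2) by simp
    also have "\<dots> = c k \<bullet> Idt C (X k)" using Cmp_Idt[OF ck] by simp
    finally have "t (s k) = k \<and> b (s k) \<bullet> a k = Idt C (X k)"
      using connected_factor_unique[OF conn X(1) tsk k Cmp_Hom[OF ak(1) bsk(1)]]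
        Idt_Hom HomD[OF ck] by blast
    then show "t (s k) = k" "b (s k) \<bullet> a k = Idt C (X k)" by auto
  qed
  have XY: "\<forall>k<n. connected_object C (X k)" "\<forall>k<m. connected_object C (Y k)"
    using X(2) Y(2) by auto
  note ts = inverse[OF X(1) XY(1) a' b'] and st = inverse[OF Y(1) XY(2) b' a']
  have bij: "bij_betw s {..<n} {..<m}"
    by (rule bij_betw_byWitness[where f' = t]) (use a(1) b(1) ts(1) st(1) in auto)
  have cls: "iso_class C (Y (s k)) = iso_class C (X k)" if k: "k < n" for k
  proof -
    have bk: "b (s k) \<in> Hom C (Y (s k)) (X k)" using b(2)[OF a(1)[OF k]] ts(1)[OF k] by simp
    have "a k \<bullet> b (s k) = Idt C (Y (s k))"
      using st(2)[OF a(1)[OF k]] ts(1)[OF k] by simp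
    then have "isomorphic C (Y (s k)) (X k)"
      using isomorphicI[OF bk a(2)[OF k]] ts(2)[OF k] by simp
    then show ?thesis using iso_class_eq_iff HomD[OF bk] by blast
  qed
  \<comment> \<open>As multisets over the index sets, the two families differ by reindexing along
    the bijection \<open>s\<close>.\<close>
  have "image_mset (\<lambda>k. iso_class C (Y k)) (mset_set {..<m})
      = image_mset (\<lambda>k. iso_class C (Y k)) (image_mset s (mset_set {..<n}))"
    using bij by (simp add: bij_betw_def image_mset_mset_set)
  also have "\<dots> = image_mset (\<lambda>k. iso_class C (X k)) (mset_set {..<n})"
    unfolding image_mset.compositionality by (rule image_mset_cong) (simp add: cls)
  finally show ?thesis by (simp add: atLeast0LessThan)
qed

section \<open>Freeness of the monoid on the connected classes\<close>

abbreviation connected_classes :: "'a set set"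
  where "connected_classes \<equiv> iso_class C ` {D. connected_object C D}"

lemma connected_classes_carrier: "connected_classes \<subseteq> carrier (dec_monoid C)"
  using iso_class_in_dec by (auto simp: connected_object_def)

lemma dec_sum_append:
  assumes "set es \<subseteq> connected_classes" "set fs \<subseteq> connected_classes"
  shows "dec_sum (es @ fs) = dec_sum es \<otimes>\<^bsub>dec_monoid C\<^esub> dec_sum fs"
proof -
  have "set fs \<subseteq> carrier (dec_monoid C)" using assms(2) connected_classes_carrier by blast
  then have "dec_sum fs \<in> carrier (dec_monoid C)" by (rule Dec.multlist_closed)
  moreover have "set es \<subseteq> carrier (dec_monoid C)" using assms(1) connected_classes_carrier by blast
  ultimately show ?thesis
    by (induction es) (simp_all add: Dec.m_assoc Dec.multlist_closed)
qed

text \<open>The class may have been given by another connected representative, so connectedness is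
  carried along an isomorphism.\<close>

lemma connected_classesD: "iso_class C A \<in> connected_classes \<Longrightarrow> A \<in> Obj C \<Longrightarrow> connected_object C A"
  using connected_isomorphic iso_class_eq_iff
  by (metis (no_types, lifting) connected_object_def imageE mem_Collect_eq)

text \<open>Equal sums are equal sets of objects, so one object \<open>S\<close> lies in both and
  acquires two decompositions with the same apex, as the Krull-Schmidt statement requires.\<close>

lemma dec_sum_connected_unique:
  assumes "set es \<subseteq> connected_classes" "set fs \<subseteq> connected_classes" "dec_sum es = dec_sum fs"
  shows "mset es = mset fs"
proof -
  have car: "set es \<subseteq> carrier (dec_monoid C)" "set fs \<subseteq> carrier (dec_monoid C)"
    using assms(1,2) connected_classes_carrier by auto
  obtain S where S: "S \<in> Obj C" "dec_sum es = iso_class C S"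
    using dec_carrierE[OF Dec.multlist_closed[OF car(1)]] by blast
  have "S \<in> dec_sum es" "S \<in> dec_sum fs" using S iso_class_self assms(3) by auto
  obtain X c where X: "is_coproduct C {..<length es} X S c"
    "map (\<lambda>k. iso_class C (X k)) [0..<length es] = rev es"
    using dec_sum_coproduct[OF car(1) \<open>S \<in> dec_sum es\<close>] .
  obtain Y d where Y: "is_coproduct C {..<length fs} Y S d"
    "map (\<lambda>k. iso_class C (Y k)) [0..<length fs] = rev fs"
    using dec_sum_coproduct[OF car(2) \<open>S \<in> dec_sum fs\<close>] .
  have conn: "connected_object C (X k)"
    if "is_coproduct C {..<length es} X S c" "set es \<subseteq> connected_classes"
      "map (\<lambda>k. iso_class C (X k)) [0..<length es] = rev es" "k < length es" for X c es k
  proof -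
    have "iso_class C (X k) \<in> set (map (\<lambda>k. iso_class C (X k)) [0..<length es])"
      using that(4) by auto
    then have "iso_class C (X k) \<in> connected_classes" unfolding that(3) using that(2) by auto
    then show ?thesis using connected_classesD coproduct_obj(2)[OF that(1)] that(4) by blast
  qed
  from connected_decomposition_unique[OF X(1) conn[OF X(1) assms(1) X(2)] Y(1) conn[OF Y(1) assms(2) Y(2)]]
  show ?thesis unfolding X(2) Y(2) by simp
qed

text \<open>Turns the condition on objects into generation of the monoid by connected classes, so
  that the later inductions run over lists of classes.\<close>

lemma finite_coproducts_of_connected_iff:
  "finite_coproducts_of_connected C \<longleftrightarrow>
    (\<forall>x\<in>carrier (dec_monoid C). \<exists>es. set es \<subseteq> connected_classes \<and> x = dec_sum es)"
proof
  assume l: "finite_coproducts_of_connected C"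
  show "\<forall>x\<in>carrier (dec_monoid C). \<exists>es. set es \<subseteq> connected_classes \<and> x = dec_sum es"
  proof
    fix x assume "x \<in> carrier (dec_monoid C)"
    then obtain A where A: "A \<in> Obj C" "x = iso_class C A" by (rule dec_carrierE)
    then obtain n X c where X: "\<forall>k<n. connected_object C (X k)" "is_coproduct C {..<n::nat} X A c"
      using l unfolding finite_coproducts_of_connected_def by blast
    have "x = dec_sum (map (\<lambda>k. iso_class C (X k)) (rev [0..<n]))"
      using coproduct_dec_sum[OF X(2)] A(2) by simp
    moreover have "set (map (\<lambda>k. iso_class C (X k)) (rev [0..<n])) \<subseteq> connected_classes"
      using X(1) by auto
    ultimately show "\<exists>es. set es \<subseteq> connected_classes \<and> x = dec_sum es" by blast
  qed
next
  assume r: "\<forall>x\<in>carrier (dec_monoid C). \<exists>es. set es \<subseteq> connected_classes \<and> x = dec_sum es"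
  show "finite_coproducts_of_connected C"
    unfolding finite_coproducts_of_connected_def
  proof
    fix A assume A: "A \<in> Obj C"
    then obtain es where es: "set es \<subseteq> connected_classes" "iso_class C A = dec_sum es"
      using r iso_class_in_dec by blast
    have car: "set es \<subseteq> carrier (dec_monoid C)" and mem: "A \<in> dec_sum es"
      using es connected_classes_carrier iso_class_self[OF A] by auto
    obtain X c where X: "is_coproduct C {..<length es} X A c"
      "map (\<lambda>k. iso_class C (X k)) [0..<length es] = rev es"
      using dec_sum_coproduct[OF car mem] .
    have "connected_object C (X k)" if k: "k < length es" for k
    proof -
      have "iso_class C (X k) \<in> set (map (\<lambda>k. iso_class C (X k)) [0..<length es])" using k by auto
      then have "iso_class C (X k) \<in> connected_classes" unfolding X(2) using es(1) by auto
      then show ?thesis using connected_classesD coproduct_obj(2)[OF X(1)] k by blast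
    qed
    then show "\<exists>(n::nat) X c. (\<forall>k<n. connected_object C (X k)) \<and> is_coproduct C {..<n} X A c"
      using X(1) by blast
  qed
qed

text \<open>Cancellation is inherited from multisets: appending the same list to two others and
  comparing multisets removes the common part.\<close>

lemma dec_cancel:
  assumes fc: "finite_coproducts_of_connected C"
    and x: "x \<in> carrier (dec_monoid C)" and y: "y \<in> carrier (dec_monoid C)"
    and z: "z \<in> carrier (dec_monoid C)"
    and e: "x \<otimes>\<^bsub>dec_monoid C\<^esub> z = y \<otimes>\<^bsub>dec_monoid C\<^esub> z"
  shows "x = y"
proof -
  obtain es fs gs where es: "set es \<subseteq> connected_classes" "x = dec_sum es"
    and fs: "set fs \<subseteq> connected_classes" "y = dec_sum fs"
    and gs: "set gs \<subseteq> connected_classes" "z = dec_sum gs"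
    using fc x y z unfolding finite_coproducts_of_connected_iff by metis
  have "dec_sum (es @ gs) = dec_sum (fs @ gs)"
    unfolding dec_sum_append[OF es(1) gs(1)] dec_sum_append[OF fs(1) gs(1)] using e es fs gs by simp
  from dec_sum_connected_unique[OF _ _ this] es fs gs have "mset es = mset fs" by simp
  then show ?thesis using Dec.multlist_perm_cong[of es fs] es(1) connected_classes_carrier es(2) fs(2) by auto
qed

end

section \<open>Extensive categories\<close>

context category
begin

lemma pullbackI:
  assumes "f \<in> Hom C A S" "i \<in> Hom C X S" "p \<in> Hom C P A" "q \<in> Hom C P X" "f \<bullet> p = i \<bullet> q"
    and "\<And>T a b. a \<in> Hom C T A \<Longrightarrow> b \<in> Hom C T X \<Longrightarrow> f \<bullet> a = i \<bullet> b
      \<Longrightarrow> \<exists>!u. u \<in> Hom C T P \<and> p \<bullet> u = a \<and> q \<bullet> u = b"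
  shows "is_pullback C P p q f i"
proof -
  have "f \<in> Arr C" "Dom C f = A" "Cod C f = S" "i \<in> Arr C" "Dom C i = X" "Cod C i = S"
    using assms(1,2) by (auto simp: Hom_def)
  moreover have "P \<in> Obj C" using HomD[OF assms(3)] by simp
  ultimately show ?thesis using assms(3-6) unfolding is_pullback_def by simp
qed

lemma pullbackD:
  assumes "is_pullback C P p q f i" "f \<in> Hom C A S" "i \<in> Hom C X S"
  shows "p \<in> Hom C P A" "q \<in> Hom C P X" "f \<bullet> p = i \<bullet> q"
    "a \<in> Hom C T A \<Longrightarrow> b \<in> Hom C T X \<Longrightarrow> f \<bullet> a = i \<bullet> b
      \<Longrightarrow> \<exists>!u. u \<in> Hom C T P \<and> p \<bullet> u = a \<and> q \<bullet> u = b"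
proof -
  have d: "Dom C f = A" "Dom C i = X" using assms(2,3) by (auto simp: Hom_def)
  show "p \<in> Hom C P A" "q \<in> Hom C P X" "f \<bullet> p = i \<bullet> q"
    using assms(1) unfolding is_pullback_def d by auto
  assume a: "a \<in> Hom C T A" "b \<in> Hom C T X" "f \<bullet> a = i \<bullet> b"
  have "T \<in> Obj C" using HomD[OF a(1)] by simp
  then show "\<exists>!u. u \<in> Hom C T P \<and> p \<bullet> u = a \<and> q \<bullet> u = b"
    using assms(1) a unfolding is_pullback_def d by simp
qed

end

locale extensive_category = category +
  assumes extensive: "extensive C"

sublocale extensive_category \<subseteq> category_with_coproducts
  by unfold_locales (use extensive in \<open>simp add: extensive_def\<close>)

context extensive_category
begin

section \<open>Monic and disjoint coprojections, strict initial objects\<close>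

lemma extensive_iff:
  assumes "is_coproduct2 C X Y S i j" "f \<in> Hom C A S"
    and "a \<in> Hom C A1 A" "b \<in> Hom C A2 A" "g \<in> Hom C A1 X" "h \<in> Hom C A2 Y"
    and "f \<bullet> a = i \<bullet> g" "f \<bullet> b = j \<bullet> h"
  shows "is_coproduct2 C A1 A2 A a b \<longleftrightarrow> is_pullback C A1 a g f i \<and> is_pullback C A2 b h f j"
  using extensive[unfolded extensive_def, THEN conjunct2, rule_format, OF assms(1), THEN conjunct2,
      rule_format, of a A1 A b A2 g h f] assms(2-) by blast

text \<open>Extensivity is applied to the row \<open>X \<rightarrow> X \<leftarrow> Z\<close> over
  \<open>X \<rightarrow> S \<leftarrow> Y\<close> with middle vertical map \<open>i\<close>. The
  upper row is the coproduct of \<open>X\<close> with the initial object, so both squares are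
  pullbacks: the first makes coprojections monic, the second makes them disjoint.\<close>

lemma coprojection_pullbacks:
  assumes S: "is_coproduct2 C X Y S i j" and Z: "is_initial C Z"
    and z: "z \<in> Hom C Z X" "w \<in> Hom C Z Y"
  shows "is_pullback C X (Idt C X) (Idt C X) i i" "is_pullback C Z z w i j"
proof -
  note o = coproduct2_obj[OF S]
  have "i \<bullet> z = j \<bullet> w" using initial_unique[OF Z Cmp_Hom[OF z(1) o(4)] Cmp_Hom[OF z(2) o(5)]] .
  from extensive_iff[OF S o(4) Idt_Hom[OF o(1)] z(1) Idt_Hom[OF o(1)] z(2) refl this]
  show "is_pullback C X (Idt C X) (Idt C X) i i" "is_pullback C Z z w i j"
    using coproduct2_initial[OF Z z(1)] by auto
qed

text \<open>Two maps identified by \<open>i\<close> form a cone over the pair \<open>i\<close>,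
  \<open>i\<close>, whose pullback has the identity as both legs.\<close>

lemma coprojection_mono:
  assumes S: "is_coproduct2 C X Y S i j" and "f \<in> Hom C A X" "g \<in> Hom C A X" "i \<bullet> f = i \<bullet> g"
  shows "f = g"
proof -
  note o = coproduct2_obj[OF S]
  obtain Z where Z: "is_initial C Z" by (rule initial_exists)
  obtain z where z: "z \<in> Hom C Z X" using initialE[OF Z o(1)] .
  obtain w where w: "w \<in> Hom C Z Y" using initialE[OF Z o(2)] .
  obtain u where "u \<in> Hom C A X" "Idt C X \<bullet> u = f" "Idt C X \<bullet> u = g"
    using pullbackD(4)[OF coprojection_pullbacks(1)[OF S Z z w] o(4) o(4) assms(2-4)] by blast
  then show ?thesis by simp
qed

text \<open>Over \<open>Z + Z = Z\<close>, the row of two identities of \<open>A\<close>, with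
  \<open>f\<close> as every vertical map, consists of pullback squares. Hence \<open>A\<close> with
  two identities is a coproduct of \<open>A\<close> and \<open>A\<close>, and copairing two maps out
  of \<open>A\<close> forces them to be equal. Maps out of \<open>A\<close> exist through
  \<open>f\<close>.\<close>

lemma initial_strict:
  assumes Z: "is_initial C Z" and f: "f \<in> Hom C A Z"
  shows "is_initial C A"
proof -
  have A: "A \<in> Obj C" and ZO: "Z \<in> Obj C" using HomD[OF f] by auto
  note idA = Idt_Hom[OF A] and idZ = Idt_Hom[OF ZO]
  have ZZ: "is_coproduct2 C Z Z Z (Idt C Z) (Idt C Z)" by (rule coproduct2_initial[OF Z idZ])
  have sq: "f \<bullet> Idt C A = Idt C Z \<bullet> f" using Cmp_Idt[OF f] Idt_Cmp[OF f] by simp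
  have "is_pullback C A (Idt C A) f f (Idt C Z)"
  proof (rule pullbackI[OF f idZ idA f sq])
    fix T a b assume a: "a \<in> Hom C T A" "b \<in> Hom C T Z" "f \<bullet> a = Idt C Z \<bullet> b"
    show "\<exists>!u. u \<in> Hom C T A \<and> Idt C A \<bullet> u = a \<and> f \<bullet> u = b"
    proof (rule ex1I[of _ a])
      show "a \<in> Hom C T A \<and> Idt C A \<bullet> a = a \<and> f \<bullet> a = b"
        using a Idt_Cmp[OF a(1)] Idt_Cmp[OF a(2)] by simp
      show "u = a" if "u \<in> Hom C T A \<and> Idt C A \<bullet> u = a \<and> f \<bullet> u = b" for u
        using that Idt_Cmp[of u T A] by simp
    qed
  qed
  then have AA: "is_coproduct2 C A A A (Idt C A) (Idt C A)"
    using extensive_iff[OF ZZ f idA idA f f sq sq] by simp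
  show ?thesis
    unfolding is_initial_def
  proof (intro conjI ballI A)
    fix T assume T: "T \<in> Obj C"
    obtain t where t: "t \<in> Hom C Z T" using initialE[OF Z T] .
    have "g = h" if g: "g \<in> Hom C A T" and h: "h \<in> Hom C A T" for g h
    proof -
      obtain u where "u \<in> Hom C A T" "u \<bullet> Idt C A = g" "u \<bullet> Idt C A = h"
        using coproduct2_copair[OF AA g h] .
      then show ?thesis by simp
    qed
    then show "\<exists>!g. g \<in> Hom C A T" using Cmp_Hom[OF f t] by blast
  qed
qed

text \<open>The pullback of the two coprojections is initial, so the cone given by \<open>f\<close>
  and \<open>g\<close> yields a map from \<open>A\<close> to an initial object, and strictness
  applies.\<close>

lemma coprojections_disjoint:
  assumes S: "is_coproduct2 C X Y S i j" and f: "f \<in> Hom C A X" and g: "g \<in> Hom C A Y"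
    and e: "i \<bullet> f = j \<bullet> g"
  shows "is_initial C A"
proof -
  note o = coproduct2_obj[OF S]
  obtain Z where Z: "is_initial C Z" by (rule initial_exists)
  obtain z where z: "z \<in> Hom C Z X" using initialE[OF Z o(1)] .
  obtain w where w: "w \<in> Hom C Z Y" using initialE[OF Z o(2)] .
  obtain u where "u \<in> Hom C A Z"
    using pullbackD(4)[OF coprojection_pullbacks(2)[OF S Z z w] o(4) o(5) f g e] by blast
  then show ?thesis by (rule initial_strict[OF Z])
qed

text \<open>Here extensivity is read from pullbacks to coproducts: a decomposition of the codomain
  induces one of the domain.\<close>

lemma pullback_coproduct2:
  assumes S: "is_coproduct2 C X Y S i j" and f: "f \<in> Hom C A S"
  obtains A1 A2 a b g h where "is_coproduct2 C A1 A2 A a b" "g \<in> Hom C A1 X" "h \<in> Hom C A2 Y"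
    "f \<bullet> a = i \<bullet> g" "f \<bullet> b = j \<bullet> h"
proof -
  note o = coproduct2_obj[OF S]
  have ex: "\<exists>P p q. is_pullback C P p q f i'" if "is_coproduct2 C X' Y' S i' j'" for X' Y' i' j'
    using extensive[unfolded extensive_def, THEN conjunct2, rule_format, OF that, THEN conjunct1] f
    by blast
  obtain A1 a g where 1: "is_pullback C A1 a g f i" using ex[OF S] by blast
  \<comment> \<open>The definition supplies pullbacks along the first coprojection; the one along
    the second comes from exchanging the summands.\<close>
  obtain A2 b h where 2: "is_pullback C A2 b h f j" using ex[OF coproduct2_sym[OF S]] by blast
  note p1 = pullbackD(1-3)[OF 1 f o(4)] and p2 = pullbackD(1-3)[OF 2 f o(5)]
  show thesis
    using that[OF _ p1(2) p2(2) p1(3) p2(3)]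
      extensive_iff[OF S f p1(1) p2(1) p1(2) p2(2) p1(3) p2(3)] 1 2 by blast
qed

text \<open>A map \<open>f\<close> into a coproduct splits \<open>A\<close> into two parts, one of
  which is initial. The coprojection of the other part is then invertible, and \<open>f\<close>
  factors through the corresponding summand. Non-initiality of \<open>A\<close> is what disjointness
  contradicts.\<close>

lemma indecomposable_connected:
  assumes A: "A \<in> Obj C" "\<not> is_initial C A"
    and ind: "\<And>B D i j. is_coproduct2 C B D A i j \<Longrightarrow> is_initial C B \<or> is_initial C D"
  shows "connected_object C A"
  unfolding connected_object_iff inj_on_def
proof (intro conjI allI impI ballI A)
  fix X Y S i j assume S: "is_coproduct2 C X Y S i j"
  note o = coproduct2_obj[OF S]
  show "f = g" if "f \<in> Hom C A X" "g \<in> Hom C A X" "i \<bullet> f = i \<bullet> g" for f g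
    using coprojection_mono[OF S that] .
  show "f = g" if "f \<in> Hom C A Y" "g \<in> Hom C A Y" "j \<bullet> f = j \<bullet> g" for f g
    using coprojection_mono[OF coproduct2_sym[OF S] that] .
  show "i \<bullet> f \<noteq> j \<bullet> g" if "f \<in> Hom C A X" "g \<in> Hom C A Y" for f g
    using coprojections_disjoint[OF S that] A(2) by blast
  fix f assume f: "f \<in> Hom C A S"
  obtain A1 A2 a b g h where A12: "is_coproduct2 C A1 A2 A a b"
    and g: "g \<in> Hom C A1 X" "f \<bullet> a = i \<bullet> g" and h: "h \<in> Hom C A2 Y" "f \<bullet> b = j \<bullet> h"
    using pullback_coproduct2[OF S f] by metis
  note p = coproduct2_obj[OF A12]
  have lift: "f = i \<bullet> g \<bullet> k"
    if "i \<in> Hom C X S" "g \<in> Hom C B X" "f \<bullet> b = i \<bullet> g" "b \<in> Hom C B A" "k \<in> Hom C A B"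
      "b \<bullet> k = Idt C A" for i g X b k B
    using Cmp_assoc[OF that(5,2,1)] Cmp_assoc[OF that(5,4) f] that(3,6) Cmp_Idt[OF f] by simp
  from ind[OF A12] show "(\<exists>g\<in>Hom C A X. f = i \<bullet> g) \<or> (\<exists>g\<in>Hom C A Y. f = j \<bullet> g)"
  proof
    assume "is_initial C A1"
    from coproduct2_with_initial[OF A12 this]
    obtain k where k: "k \<in> Hom C A A2" "b \<bullet> k = Idt C A" by blast
    have "f = j \<bullet> h \<bullet> k" using lift[OF o(5) h p(5) k] .
    then show ?thesis using Cmp_Hom[OF k(1) h(1)] by blast
  next
    assume "is_initial C A2"
    from coproduct2_with_initial[OF coproduct2_sym[OF A12] this]
    obtain k where k: "k \<in> Hom C A A1" "a \<bullet> k = Idt C A" by blast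
    have "f = i \<bullet> g \<bullet> k" using lift[OF o(4) g p(4) k] .
    then show ?thesis using Cmp_Hom[OF k(1) g(1)] by blast
  qed
qed

text \<open>Each summand of \<open>A\<close> may be sent to either copy of \<open>T\<close> in \<open>T + T\<close>.\<close>

lemma two_power_le_card_Hom:
  assumes lf: "locally_finite C" and U: "is_coproduct2 C T T U i j"
    and "set es \<subseteq> carrier (dec_monoid C)" "\<one>\<^bsub>dec_monoid C\<^esub> \<notin> set es" "A \<in> dec_sum es" "Hom C A T \<noteq> {}"
  shows "2 ^ length es \<le> card (Hom C A U)"
  using assms(3-)
proof (induction es arbitrary: A)
  case Nil
  have "finite (Hom C A U)" "Hom C A U \<noteq> {}"
    using lf Nil.prems(4) HomD Cmp_Hom[OF _ coproduct2_obj(4)[OF U]] coproduct2_obj(3)[OF U]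
    unfolding locally_finite_def by blast+
  then show ?case by (simp add: Suc_le_eq card_gt_0_iff)
next
  case (Cons e es)
  note o = coproduct2_obj[OF U]
  obtain B D k l where B: "B \<in> e" and D: "D \<in> dec_sum es" and A: "is_coproduct2 C B D A k l"
    using Cons.prems(3) by (auto elim: dec_mult_memE)
  note p = coproduct2_obj[OF A]
  obtain f where f: "f \<in> Hom C A T" using Cons.prems(4) by blast
  have fB: "f \<bullet> k \<in> Hom C B T" and fD: "f \<bullet> l \<in> Hom C D T" using f p Cmp_Hom by blast+
  have "2 ^ length es \<le> card (Hom C D U)"
    using Cons.IH[OF _ _ D] Cons.prems(1,2) fD by auto
  moreover have "2 \<le> card (Hom C B U)"
  proof -
    have "e = iso_class C B" using dec_carrier_memE(2)[OF _ B] Cons.prems(1) by simp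
    then have "\<not> is_initial C B" using Cons.prems(2) dec_monoid_zero by auto
    \<comment> \<open>Equality would make \<open>B\<close> initial by disjointness, whereas the unit
      class is excluded from the list.\<close>
    then have "i \<bullet> f \<bullet> k \<noteq> j \<bullet> f \<bullet> k" using coprojections_disjoint[OF U fB fB] by blast
    then have "2 = card {i \<bullet> f \<bullet> k, j \<bullet> f \<bullet> k}" by simp
    also have "\<dots> \<le> card (Hom C B U)"
      using lf p(1) o(3) Cmp_Hom[OF fB o(4)] Cmp_Hom[OF fB o(5)]
      by (intro card_mono) (auto simp: locally_finite_def)
    finally show ?thesis .
  qed
  ultimately have "2 * 2 ^ length es \<le> card (Hom C B U) * card (Hom C D U)"
    by (rule_tac mult_mono) auto
  then show ?case by (simp add: card_Hom_coproduct2[OF A])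
qed

text \<open>Induction on the greatest length of an expression of \<open>x\<close> as a sum of
  non-zero classes. The bound on \<open>2 ^ length es\<close> makes this maximum exist, and a proper
  splitting of \<open>x\<close> strictly lowers it for both parts.\<close>

lemma locally_finite_decomposition:
  assumes lf: "locally_finite C"
  shows "finite_coproducts_of_connected C"
  unfolding finite_coproducts_of_connected_iff
proof
  let ?M = "dec_monoid C"
  \<comment> \<open>The terms need not be connected; excluding the unit is what keeps the lengths
    bounded.\<close>
  define L where "L x = {es. set es \<subseteq> carrier ?M \<and> \<one>\<^bsub>?M\<^esub> \<notin> set es \<and> dec_sum es = x}" for x
  define d where "d x = Max (length ` L x)" for x
  have fin: "finite (length ` L x)" if x: "x \<in> carrier ?M" for x
  proof -
    obtain A where A: "A \<in> Obj C" "x = iso_class C A" using x by (rule dec_carrierE)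
    obtain U i j where U: "is_coproduct2 C A A U i j" using coproduct2_exists[OF A(1) A(1)] .
    have "length es \<le> card (Hom C A U)" if "es \<in> L x" for es
    proof -
      \<comment> \<open>The target of the bound is taken to be \<open>A\<close> itself, so the
        identity provides the required map.\<close>
      have "2 ^ length es \<le> card (Hom C A U)"
        using two_power_le_card_Hom[OF lf U, of es A] that A iso_class_self Idt_Hom by (auto simp: L_def)
      then show ?thesis using less_exp[of "length es"] by linarith
    qed
    then have "length ` L x \<subseteq> {..card (Hom C A U)}" by blast
    then show ?thesis by (rule finite_subset) simp
  qed
  fix x assume "x \<in> carrier ?M"
  then show "\<exists>es. set es \<subseteq> connected_classes \<and> x = dec_sum es"
  proof (induction "d x" arbitrary: x rule: less_induct)
    case less
    note x = less.prems
    obtain A where A: "A \<in> Obj C" "x = iso_class C A" using x by (rule dec_carrierE)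
    \<comment> \<open>The third case is the failure of indecomposability for an object that is
      neither initial nor connected.\<close>
    consider (unit) "x = \<one>\<^bsub>?M\<^esub>" | (conn) "connected_object C A" |
      (split) B D i j where "is_coproduct2 C B D A i j" "\<not> is_initial C B" "\<not> is_initial C D"
        "x \<noteq> \<one>\<^bsub>?M\<^esub>"
      using indecomposable_connected[OF A(1)] dec_monoid_zero A(2) by blast
    then show ?case
    proof cases
      case unit
      then show ?thesis by (intro exI[of _ "[]"]) simp
    next
      case conn
      then show ?thesis using x A(2) by (intro exI[of _ "[x]"]) auto
    next
      case split
      define y z where "y = iso_class C B" and "z = iso_class C D"
      have yz: "y \<in> carrier ?M" "z \<in> carrier ?M"
        using coproduct2_obj[OF split(1)] iso_class_in_dec by (auto simp: y_def z_def)
      have xyz: "x = y \<otimes>\<^bsub>?M\<^esub> z" using dec_monoid_add[OF split(1)] A(2) by (simp add: y_def z_def)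
      have ne: "y \<noteq> \<one>\<^bsub>?M\<^esub>" "z \<noteq> \<one>\<^bsub>?M\<^esub>"
        using split(2,3) iso_class_self coproduct2_obj[OF split(1)]
        by (auto simp: y_def z_def dec_monoid_def)
      \<comment> \<open>Putting \<open>v\<close> in front of a longest expression of
        \<open>u\<close> gives a longer expression of \<open>x\<close>. The list \<open>[u]\<close>
        ensures that the maximum for \<open>u\<close> is taken over a non-empty set.\<close>
      have smaller: "d u < d x" if u: "u \<in> carrier ?M" "u \<noteq> \<one>\<^bsub>?M\<^esub>" and v: "v \<in> carrier ?M" "v \<noteq> \<one>\<^bsub>?M\<^esub>"
        and uv: "x = v \<otimes>\<^bsub>?M\<^esub> u" for u v
      proof -
        have "[u] \<in> L u" using u by (simp add: L_def)
        then obtain es where es: "es \<in> L u" "d u = length es"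
          using Max_in[OF fin[OF u(1)]] by (auto simp: d_def)
        have "v # es \<in> L x" using es(1) v uv by (auto simp: L_def)
        then have "Suc (length es) \<in> length ` L x" by force
        then show ?thesis using Max_ge[OF fin[OF x]] es(2) by (fastforce simp: d_def)
      qed
      obtain es fs where es: "set es \<subseteq> connected_classes" "y = dec_sum es"
        and fs: "set fs \<subseteq> connected_classes" "z = dec_sum fs"
        using less.hyps[OF smaller[OF yz(1) ne(1) yz(2) ne(2)] yz(1)]
          less.hyps[OF smaller[OF yz(2) ne(2) yz(1) ne(1) xyz] yz(2)]
          xyz Dec.m_comm[OF yz] by auto
      have "x = dec_sum (es @ fs)"
        using xyz dec_sum_append[OF es(1) fs(1)] es(2) fs(2) by simp
      then show ?thesis using es(1) fs(1) by (intro exI[of _ "es @ fs"]) auto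
    qed
  qed
qed

end

section \<open>Combinatorial categories\<close>

context category
begin

section \<open>Counting maps into an object, by duality\<close>

lemma card_Hom_isomorphic_cod:
  assumes "isomorphic C A B"
  shows "card (Hom C D A) = card (Hom C D B)"
  using category.card_Hom_isomorphic_dom[OF category_opposite, of A B D] assms
  by (simp add: isomorphic_opposite Hom_opposite)

lemma card_Hom_product2:
  assumes "is_product2 C A B P p q"
  shows "card (Hom C D P) = card (Hom C D A) * card (Hom C D B)"
  using category.card_Hom_coproduct2[OF category_opposite, of A B P p q D] assms
  by (simp add: is_coproduct2_opposite Hom_opposite)

lemma card_Hom_initial:
  assumes "is_initial C Z" "T \<in> Obj C"
  shows "card (Hom C Z T) = 1"
proof -
  obtain f where "f \<in> Hom C Z T" using initialE[OF assms] .
  then have "Hom C Z T = {f}" using initial_unique[OF assms(1)] by blast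
  then show ?thesis by simp
qed

lemma card_Hom_terminal: "is_terminal C Z \<Longrightarrow> T \<in> Obj C \<Longrightarrow> card (Hom C T Z) = 1"
  using category.card_Hom_initial[OF category_opposite, of Z T]
  by (simp add: is_initial_opposite Hom_opposite opposite_simps)

text \<open>The count is constant on the class and the class is non-empty, so its image is a
  singleton and \<open>the_elem\<close> is meaningful.\<close>

lemma hom_count_iso_class:
  assumes "A \<in> Obj C"
  shows "hom_count C D (iso_class C A) = card (Hom C D A)"
proof -
  have "(\<lambda>B. card (Hom C D B)) ` iso_class C A = (\<lambda>_. card (Hom C D A)) ` iso_class C A"
    by (rule image_cong) (auto simp: iso_class_def card_Hom_isomorphic_cod)
  then show ?thesis using iso_class_self[OF assms] by (simp add: hom_count_def image_constant)
qed

end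

lemma has_finite_coproducts_opposite:
  "has_finite_coproducts (opposite C) \<longleftrightarrow> has_finite_products C"
  by (simp add: has_finite_coproducts_def has_finite_products_def is_coproduct_def is_product_def
      Hom_opposite opposite_simps)

text \<open>\<open>decomposition\<close> is available under both alternatives of the theorem, so the
  arguments below need not distinguish them.\<close>

locale combinatorial_category = category_with_coproducts C
  for C :: "('o, 'm) category_data" +
  fixes I :: "'i set" and R :: "'i \<Rightarrow> 'o"
  assumes combinatorial: "combinatorial C"
    and decomposition: "finite_coproducts_of_connected C"
    and representatives: "connected_representatives C I R"
begin

lemma locally_finite: "locally_finite C"
  using combinatorial by (simp add: combinatorial_def)

lemma connected_R: "i \<in> I \<Longrightarrow> connected_object C (R i)"
  using representatives by (simp add: connected_representatives_def)

lemma hom_count_add: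
  assumes D: "connected_object C D" and "x \<in> carrier (dec_monoid C)" "y \<in> carrier (dec_monoid C)"
  shows "hom_count C D (x \<otimes>\<^bsub>dec_monoid C\<^esub> y) = hom_count C D x + hom_count C D y"
proof -
  obtain A B where A: "A \<in> Obj C" "x = iso_class C A" and B: "B \<in> Obj C" "y = iso_class C B"
    using assms(2,3) by (metis dec_carrierE)
  obtain S i j where S: "is_coproduct2 C A B S i j" using coproduct2_exists[OF A(1) B(1)] .
  show ?thesis
    using dec_monoid_add[OF S] A B coproduct2_obj(3)[OF S] card_Hom_connected[OF D S locally_finite]
    by (simp add: hom_count_iso_class)
qed

lemma hom_count_zero:
  assumes D: "connected_object C D"
  shows "hom_count C D \<one>\<^bsub>dec_monoid C\<^esub> = 0"
proof -
  obtain Z where Z: "is_initial C Z" by (rule initial_exists)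
  then have "Z \<in> Obj C" by (simp add: is_initial_def)
  then show ?thesis
    using connected_Hom_initial[OF D Z] by (simp add: dec_monoid_zero[OF Z] hom_count_iso_class)
qed

text \<open>Since \<open>Hom (X + Y, A) = Hom (X, A) \<times> Hom (Y, A)\<close>, the counts at connected objects
  determine the counts at all objects.\<close>

lemma hom_count_separates:
  assumes x: "x \<in> carrier (dec_monoid C)" and y: "y \<in> carrier (dec_monoid C)"
    and eq: "\<And>i. i \<in> I \<Longrightarrow> hom_count C (R i) x = hom_count C (R i) y"
  shows "x = y"
proof -
  obtain A B where A: "A \<in> Obj C" "x = iso_class C A" and B: "B \<in> Obj C" "y = iso_class C B"
    using x y by (metis dec_carrierE)
  \<comment> \<open>Every connected object is isomorphic to some \<open>R i\<close>, and counts
    depend only on the isomorphism class of the domain.\<close>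
  have conn: "card (Hom C D A) = card (Hom C D B)" if D: "connected_object C D" for D
  proof -
    obtain i where i: "i \<in> I" "isomorphic C D (R i)"
      using representatives D unfolding connected_representatives_def by blast
    show ?thesis
      using eq[OF i(1)] A B card_Hom_isomorphic_dom[OF i(2)] by (simp add: hom_count_iso_class)
  qed
  have "card (Hom C X A) = card (Hom C X B)" if "X \<in> dec_sum es" "set es \<subseteq> connected_classes" for X es
    using that
  proof (induction es arbitrary: X)
    case Nil
    then show ?case using A(1) B(1) by (simp add: dec_monoid_def card_Hom_initial)
  next
    case (Cons e es)
    obtain D Y i j where D: "D \<in> e" and Y: "Y \<in> dec_sum es" and S: "is_coproduct2 C D Y X i j"
      using Cons.prems(1) by (auto elim: dec_mult_memE)
    have e: "e \<in> connected_classes" using Cons.prems(2) by simp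
    then have "e \<in> carrier (dec_monoid C)" by (rule subsetD[OF connected_classes_carrier])
    note eD = dec_carrier_memE[OF this D]
    have "connected_object C D" using e eD connected_classesD[of D] by simp
    then show ?case
      using conn Cons.IH[OF Y] Cons.prems(2) by (simp add: card_Hom_coproduct2[OF S])
  qed
  moreover have "\<exists>es. set es \<subseteq> connected_classes \<and> X \<in> dec_sum es" if X: "X \<in> Obj C" for X
    using decomposition iso_class_in_dec[OF X] iso_class_self[OF X]
    unfolding finite_coproducts_of_connected_iff by blast
  ultimately have "\<forall>X\<in>Obj C. card (Hom C X A) = card (Hom C X B)" by blast
  then have "isomorphic C A B" using combinatorial A(1) B(1) by (simp add: combinatorial_def)
  then show ?thesis using A B iso_class_eq_iff by simp
qed

text \<open>The map that \<open>hom_count_ext\<close> extends. Its values are integers because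
  \<open>groth_ext\<close> subtracts, and they are restricted to \<open>I\<close> to lie in the
  extensional product.\<close>

definition counts :: "'o set \<Rightarrow> 'i \<Rightarrow> int"
  where "counts x = (\<lambda>i\<in>I. int (hom_count_prod C I R x i))"

lemma counts_eq: "counts x = (\<lambda>i\<in>I. int (hom_count C (R i) x))"
  by (rule ext) (simp add: counts_def hom_count_prod_def)

lemma hom_count_ext_eq: "hom_count_ext C I R = groth_ext (product_group I (\<lambda>_. integer_group)) counts"
  unfolding hom_count_ext_def counts_def ..

lemma counts_hom: "counts \<in> hom (dec_monoid C) (product_group I (\<lambda>_. integer_group))"
  by (rule homI) (auto simp: counts_eq hom_count_add connected_R intro!: restrict_ext)

lemma counts_inj: "inj_on counts (carrier (dec_monoid C))"
proof (rule inj_onI)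
  fix x y assume xy: "x \<in> carrier (dec_monoid C)" "y \<in> carrier (dec_monoid C)" and e: "counts x = counts y"
  have "hom_count C (R i) x = hom_count C (R i) y" if "i \<in> I" for i
    using fun_cong[OF e, of i] that by (simp add: counts_eq)
  then show "x = y" using hom_count_separates[OF xy] by blast
qed

lemma comm_group_integer_product: "comm_group (product_group I (\<lambda>_. integer_group))"
  by (rule comm_group_product_group) (rule abelian_integer_group)

lemma hom_count_ext_groth_map:
  assumes "x \<in> carrier (dec_monoid C)" "i \<in> I"
  shows "hom_count_ext C I R (groth_map (dec_monoid C) x) i = int (hom_count_prod C I R x i)"
  unfolding hom_count_ext_eq Dec.groth_universal(2)[OF comm_group_integer_product counts_hom assms(1)]
  using assms(2) by (simp add: counts_def)

lemma hom_count_ext_hom: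
  "hom_count_ext C I R \<in> hom (groth_group (dec_monoid C)) (product_group I (\<lambda>_. integer_group))"
  unfolding hom_count_ext_eq
  by (rule Dec.groth_universal(1)[OF comm_group_integer_product counts_hom])

lemma hom_count_ext_inj: "inj_on (hom_count_ext C I R) (carrier (groth_group (dec_monoid C)))"
  unfolding hom_count_ext_eq
  by (rule Dec.groth_ext_inj[OF comm_group_integer_product counts_hom counts_inj])

end

section \<open>Products of classes and the ring homomorphism\<close>

locale combinatorial_category_with_products = combinatorial_category +
  assumes finite_products: "has_finite_products C"
begin

text \<open>In the opposite category finite products are finite coproducts, so binary products, a
  terminal object and the laws of the multiplicative monoid are inherited from the additive
  case.\<close>

sublocale Op: category_with_coproducts "opposite C"
  by (intro category_with_coproducts.intro category_opposite)
    (simp add: category_with_coproducts_axioms_def has_finite_coproducts_opposite finite_products)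

lemma product2_exists:
  assumes "A \<in> Obj C" "B \<in> Obj C"
  obtains P p q where "is_product2 C A B P p q"
  using Op.coproduct2_exists[of A B] assms by (auto simp: is_coproduct2_opposite opposite_simps)

lemma dec_semiring_comm_monoid: "comm_monoid (dec_semiring C)"
proof -
  have eqs: "carrier (dec_semiring C) = carrier (dec_monoid (opposite C))"
    "(\<otimes>\<^bsub>dec_semiring C\<^esub>) = (\<otimes>\<^bsub>dec_monoid (opposite C)\<^esub>)"
    "\<one>\<^bsub>dec_semiring C\<^esub> = \<one>\<^bsub>dec_monoid (opposite C)\<^esub>"
    by (simp_all add: dec_monoid_def dec_semiring_def iso_class_def isomorphic_opposite
        opposite_simps is_coproduct2_opposite is_initial_opposite)
  show ?thesis
    using Op.dec_comm_monoid
    unfolding comm_monoid_def monoid_def comm_monoid_axioms_def eqs .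
qed

lemma dec_semiring_simps:
  "carrier (dec_semiring C) = carrier (dec_monoid C)"
  "(\<oplus>\<^bsub>dec_semiring C\<^esub>) = (\<otimes>\<^bsub>dec_monoid C\<^esub>)" "\<zero>\<^bsub>dec_semiring C\<^esub> = \<one>\<^bsub>dec_monoid C\<^esub>"
  by (simp_all add: dec_semiring_def)

lemma dec_mult_closed:
  "x \<in> carrier (dec_monoid C) \<Longrightarrow> y \<in> carrier (dec_monoid C)
    \<Longrightarrow> x \<otimes>\<^bsub>dec_semiring C\<^esub> y \<in> carrier (dec_monoid C)"
  using monoid.m_closed[OF comm_monoid.axioms(1)[OF dec_semiring_comm_monoid]]
  unfolding dec_semiring_simps .

lemma hom_count_mult:
  assumes "x \<in> carrier (dec_monoid C)" "y \<in> carrier (dec_monoid C)"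
  shows "hom_count C D (x \<otimes>\<^bsub>dec_semiring C\<^esub> y) = hom_count C D x * hom_count C D y"
proof -
  obtain A B where A: "A \<in> Obj C" "x = iso_class C A" and B: "B \<in> Obj C" "y = iso_class C B"
    using assms by (metis dec_carrierE)
  obtain P p q where P: "is_product2 C A B P p q" using product2_exists[OF A(1) B(1)] .
  have "P \<in> Obj C" using P by (simp add: is_product2_def)
  then show ?thesis
    using dec_semiring_mult[OF P] A B card_Hom_product2[OF P] by (simp add: hom_count_iso_class)
qed

lemma hom_count_one:
  assumes "D \<in> Obj C"
  shows "hom_count C D \<one>\<^bsub>dec_semiring C\<^esub> = 1"
proof -
  obtain Z where Z: "is_terminal C Z" using Op.initial_exists by (auto simp: is_initial_opposite)
  then have "Z \<in> Obj C" by (simp add: is_terminal_def)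
  then show ?thesis
    by (simp add: dec_semiring_one[OF Z] hom_count_iso_class card_Hom_terminal[OF Z assms])
qed

text \<open>The distributive laws hold in \<open>\<nat>\<close> after counting, so they need not be proved for objects.\<close>

lemma dec_semiring_comm_semiring: "comm_semiring (dec_semiring C)"
proof (intro comm_semiring.intro semiring.intro dec_semiring_comm_monoid)
  show "abelian_monoid (dec_semiring C)"
    by (rule abelian_monoid.intro) (simp only: add_monoid_dec_semiring dec_comm_monoid)
  show "monoid (dec_semiring C)" using dec_semiring_comm_monoid by (rule comm_monoid.axioms)
  show "semiring_axioms (dec_semiring C)"
  proof
    fix x y z assume "x \<in> carrier (dec_semiring C)" "y \<in> carrier (dec_semiring C)"
      "z \<in> carrier (dec_semiring C)"
    then have c: "x \<in> carrier (dec_monoid C)" "y \<in> carrier (dec_monoid C)" "z \<in> carrier (dec_monoid C)"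
      by (simp_all only: dec_semiring_simps)
    show l: "(x \<oplus>\<^bsub>dec_semiring C\<^esub> y) \<otimes>\<^bsub>dec_semiring C\<^esub> z
        = x \<otimes>\<^bsub>dec_semiring C\<^esub> z \<oplus>\<^bsub>dec_semiring C\<^esub> y \<otimes>\<^bsub>dec_semiring C\<^esub> z"
      unfolding dec_semiring_simps
      by (rule hom_count_separates)
        (use c in \<open>simp_all add: dec_mult_closed hom_count_mult hom_count_add connected_R distrib_right\<close>)
    show "z \<otimes>\<^bsub>dec_semiring C\<^esub> (x \<oplus>\<^bsub>dec_semiring C\<^esub> y)
        = z \<otimes>\<^bsub>dec_semiring C\<^esub> x \<oplus>\<^bsub>dec_semiring C\<^esub> z \<otimes>\<^bsub>dec_semiring C\<^esub> y"
      unfolding dec_semiring_simps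
      by (rule hom_count_separates)
        (use c in \<open>simp_all add: dec_mult_closed hom_count_mult hom_count_add connected_R distrib_left\<close>)
    show "\<zero>\<^bsub>dec_semiring C\<^esub> \<otimes>\<^bsub>dec_semiring C\<^esub> x = \<zero>\<^bsub>dec_semiring C\<^esub>"
      unfolding dec_semiring_simps
      by (rule hom_count_separates)
        (use c in \<open>simp_all add: dec_mult_closed hom_count_mult hom_count_zero connected_R\<close>)
    show "x \<otimes>\<^bsub>dec_semiring C\<^esub> \<zero>\<^bsub>dec_semiring C\<^esub> = \<zero>\<^bsub>dec_semiring C\<^esub>"
      unfolding dec_semiring_simps
      by (rule hom_count_separates)
        (use c in \<open>simp_all add: dec_mult_closed hom_count_mult hom_count_zero connected_R\<close>)
  qed
qed

text \<open>The additive group of the product ring is the product of integer groups as a record, so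
  the extension formed for groups is literally the one formed for rings. Multiplicativity on classes
  comes from the universal property of products.\<close>

lemma hom_count_ext_ring_hom:
  "hom_count_ext C I R \<in> ring_hom (groth_ring (dec_semiring C)) (product_ring I (\<lambda>_. \<Z>))"
proof -
  interpret Dec_ring: comm_semiring "dec_semiring C" by (rule dec_semiring_comm_semiring)
  have Z: "cring \<Z>" by (rule int_is_cring)
  have eq: "add_monoid (product_ring I (\<lambda>_. \<Z>)) = product_group I (\<lambda>_. integer_group)"
    by (simp add: product_ring_def product_group_def)
  show ?thesis
    unfolding hom_count_ext_eq eq[symmetric]
  proof (rule Dec_ring.groth_ext_ring_hom)
    show "cring (product_ring I (\<lambda>_. \<Z>))" by (rule product_ring_cring) (rule Z)
    show "counts \<in> hom (add_monoid (dec_semiring C)) (add_monoid (product_ring I (\<lambda>_. \<Z>)))"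
      unfolding eq add_monoid_dec_semiring by (rule counts_hom)
    show "counts (x \<otimes>\<^bsub>dec_semiring C\<^esub> y) = counts x \<otimes>\<^bsub>product_ring I (\<lambda>_. \<Z>)\<^esub> counts y"
      if "x \<in> carrier (dec_semiring C)" "y \<in> carrier (dec_semiring C)" for x y
      using that unfolding dec_semiring_simps
      by (auto simp: counts_eq product_ring_def hom_count_mult intro!: restrict_ext)
    show "counts \<one>\<^bsub>dec_semiring C\<^esub> = \<one>\<^bsub>product_ring I (\<lambda>_. \<Z>)\<^esub>"
      using connected_R
      by (auto simp: counts_eq product_ring_def hom_count_one connected_object_def intro!: restrict_ext)
  qed
qed

end

section \<open>Injectivity of the canonical map and of the extended counts\<close>

theorem corollary1p13:
  fixes C :: "('o, 'm) category_data"
    and I :: "'i set"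
    and R :: "'i \<Rightarrow> 'o"
  assumes "category C"
    and "(locally_finite C \<and> extensive C) \<or>
         (has_finite_coproducts C \<and> finite_coproducts_of_connected C)"
    and "connected_representatives C I R"
  shows
    "(comm_monoid (dec_monoid C) \<and>
      comm_group (groth_group (dec_monoid C)) \<and>
      groth_map (dec_monoid C) \<in> hom (dec_monoid C) (groth_group (dec_monoid C)) \<and>
      groth_map (dec_monoid C) \<one>\<^bsub>dec_monoid C\<^esub> = \<one>\<^bsub>groth_group (dec_monoid C)\<^esub> \<and>
      inj_on (groth_map (dec_monoid C)) (carrier (dec_monoid C))) \<and>
     (combinatorial C \<longrightarrow>
       (\<forall>x\<in>carrier (dec_monoid C). \<forall>i\<in>I.
         hom_count_ext C I R (groth_map (dec_monoid C) x) i = int (hom_count_prod C I R x i)) \<and>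
       hom_count_ext C I R
         \<in> hom (groth_group (dec_monoid C)) (product_group I (\<lambda>_. integer_group)) \<and>
       inj_on (hom_count_ext C I R) (carrier (groth_group (dec_monoid C)))) \<and>
     (combinatorial C \<and> has_finite_products C \<longrightarrow>
       semiring (dec_semiring C) \<and> comm_monoid (dec_semiring C) \<and>
       cring (groth_ring (dec_semiring C)) \<and>
       groth_map (dec_monoid C) \<in> ring_hom (dec_semiring C) (groth_ring (dec_semiring C)) \<and>
       groth_map (dec_monoid C) \<zero>\<^bsub>dec_semiring C\<^esub> = \<zero>\<^bsub>groth_ring (dec_semiring C)\<^esub> \<and>
       inj_on (groth_map (dec_monoid C)) (carrier (dec_semiring C)) \<and>
       hom_count_ext C I R
         \<in> ring_hom (groth_ring (dec_semiring C)) (product_ring I (\<lambda>_. \<Z>)) \<and>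
       inj_on (hom_count_ext C I R) (carrier (groth_ring (dec_semiring C))))"
proof -
  interpret category C by fact
  \<comment> \<open>The two alternatives are merged here: what follows relies only on finite
    coproducts and decompositions.\<close>
  have decomposition: "has_finite_coproducts C \<and> finite_coproducts_of_connected C"
    using assms(2)
  proof
    assume a: "locally_finite C \<and> extensive C"
    then interpret extensive_category C by unfold_locales simp
    show ?thesis using locally_finite_decomposition finite_coproducts a by simp
  qed
  then interpret category_with_coproducts C by unfold_locales simp
  have inj: "inj_on (groth_map (dec_monoid C)) (carrier (dec_monoid C))"
    using decomposition by (intro Dec.groth_map_inj) (rule dec_cancel, auto)
  have one: "groth_map (dec_monoid C) \<one>\<^bsub>dec_monoid C\<^esub> = \<one>\<^bsub>groth_group (dec_monoid C)\<^esub>"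
    by (simp add: groth_map_def groth_group_def)
  \<comment> \<open>Combinatoriality is a premise of the later claims only, so its locale enters
    through conditional facts instead of an interpretation.\<close>
  have comb: "combinatorial_category C I R" if "combinatorial C"
    using that decomposition assms(3) by unfold_locales auto
  have products: "combinatorial_category_with_products C I R"
    if "combinatorial C" "has_finite_products C"
    using comb[OF that(1)] that(2)
    by (simp add: combinatorial_category_with_products_def
        combinatorial_category_with_products_axioms_def)
  \<comment> \<open>The ring is built on the Grothendieck group, so injectivity and preservation of
    zero for the ring are the statements already known for the group.\<close>
  have groth: "carrier (groth_ring (dec_semiring C)) = carrier (groth_group (dec_monoid C))"
    "\<zero>\<^bsub>groth_ring (dec_semiring C)\<^esub> = \<one>\<^bsub>groth_group (dec_monoid C)\<^esub>"
  proof -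
    have "add_monoid (groth_ring (dec_semiring C)) = groth_group (dec_monoid C)"
      by (simp only: add_monoid_groth_ring add_monoid_dec_semiring)
    from arg_cong[OF this, of carrier] arg_cong[OF this, of monoid.one]
    show "carrier (groth_ring (dec_semiring C)) = carrier (groth_group (dec_monoid C))"
      "\<zero>\<^bsub>groth_ring (dec_semiring C)\<^esub> = \<one>\<^bsub>groth_group (dec_monoid C)\<^esub>"
      by simp_all
  qed
  have sr: "semiring (dec_semiring C)" "comm_monoid (dec_semiring C)"
      "cring (groth_ring (dec_semiring C))"
      "groth_map (dec_monoid C) \<in> ring_hom (dec_semiring C) (groth_ring (dec_semiring C))"
    if "combinatorial C" "has_finite_products C"
  proof -
    interpret comm_semiring "dec_semiring C"
      using combinatorial_category_with_products.dec_semiring_comm_semiring[OF products[OF that]] .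
    show "semiring (dec_semiring C)" "comm_monoid (dec_semiring C)" by unfold_locales
    show "cring (groth_ring (dec_semiring C))" by (rule groth_ring_cring)
    show "groth_map (dec_monoid C) \<in> ring_hom (dec_semiring C) (groth_ring (dec_semiring C))"
      using groth_map_ring_hom by (simp only: add_monoid_dec_semiring)
  qed
  have carrier: "carrier (dec_semiring C) = carrier (dec_monoid C)" "\<zero>\<^bsub>dec_semiring C\<^esub> = \<one>\<^bsub>dec_monoid C\<^esub>"
    by (simp_all add: dec_semiring_def)
  show ?thesis
    unfolding groth carrier
    using dec_comm_monoid Dec.groth_comm_group Dec.groth_map_hom one inj sr
      combinatorial_category.hom_count_ext_groth_map[OF comb]
      combinatorial_category.hom_count_ext_hom[OF comb]
      combinatorial_category.hom_count_ext_inj[OF comb]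
      combinatorial_category_with_products.hom_count_ext_ring_hom[OF products]
    by (intro conjI impI ballI) simp_all
qed

end
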